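(* Fix $k\ge1$ and a $k$-tuple of skew shapes $\boldsymbol\mu$ of total size $n$, and let $\mathrm{Des}(\mathbf{T})=\{j:\sigma(\mathbf{T})_j=-1\}$ for $\mathbf{T}\in\mathrm{SYT}(\boldsymbol\mu)$. Then the involutions $\{D_i\}_{1<i<n}$ form a weak dual equivalence for $(\mathrm{SYT}(\boldsymbol\mu),\mathrm{Des})$, and when $k\le2$ they form a dual equivalence for $(\mathrm{SYT}(\boldsymbol\mu),\mathrm{Des})$.
   Context: Diagrams use French convention: a cell $(a,b)$ ($a$ column, $b$ row), content $c(a,b)=a-b$; skew shapes $\lambda/\mu$ are set differences of partition diagrams, not identified up to translation. $\boldsymbol\mu=(\mu^{(0)},\dots,\mu^{(k-1)})$; $\mathrm{SYT}(\boldsymbol\mu)$ is the set of bijections from the (disjoint union of) cells to $[n]$ increasing along rows and up columns in each component. Shifted content of a cell $x$ of $\mu^{(i)}$: $\tilde c(x)=k\,c(x)+i$. Content reading word $w(\mathbf{T})$: entries in increasing shifted content, equal shifted content read southwest to northeast. $\sigma(\mathbf{T})\in\{\pm1\}^{n-1}$: $\sigma_j=+1$ iff $j$ is left of $j+1$ in $w(\mathbf{T})$. $\mathrm{dist}(a,b)$ = absolute difference of the shifted contents of the cells of entries $a,b$; $\mathrm{dist}(i-1,i,i+1)$ = maximum pairwise distance. $d_i(w)$: identity if $i$ lies positionally between $i-1,i+1$; else swap $i$ with the farther of $i\pm1$. $\tilde d_i(w)$: identity if $i$ lies between; else, writing $abc$ for the subword of $i-1,i,i+1$ in positional order, replace it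 in the same positions by $bca$ if $a=i$, by $cab$ if $c=i$. $D_i(\mathbf{T})$ is the filling of the same cells with reading word $d_i(w(\mathbf{T}))$ if $\mathrm{dist}(i-1,i,i+1)>k$, and $\tilde d_i(w(\mathbf{T}))$ otherwise. For $D\subseteq[m-1]$, $Q_D(X)=\sum x_{i_1}\cdots x_{i_m}$ over $i_1\le\dots\le i_m$ with $i_j<i_{j+1}$ for $j\in D$. Given a finite set $\mathcal{A}$, $\mathrm{Des}(T)\subseteq[n-1]$, involutions $\varphi_2,\dots,\varphi_{n-1}$, for $1<h\le i<n$ let $[T]_{h,i}$ be the class of $T$ under the relation generated by $\varphi_h,\dots,\varphi_i$ and $\mathrm{Des}_{h,i}(U)=\{d-(h-2):d\in\mathrm{Des}(U)\cap\{h-1,\dots,i\}\}\subseteq[i-h+2]$. The family is a weak dual equivalence if (i) for all $1<h\le i<n$ with $i-h\le3$ and all $T$, $\sum_{U\in[T]_{h,i}}Q_{\mathrm{Des}_{h,i}(U)}(X)$ (degree $i-h+3$) is a nonnegative integer combination of Schur functions, and is a single Schur function when $h=i$; (ii) $\varphi_i\varphi_j=\varphi_j\varphi_i$ for $|i-j|\ge3$. It is a dual equivalence if moreover in (i) the sum is a single Schur function $s_\lambda$ ($\lambda$ a partition of $i-h+3$) for all such $h\le i$. *)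

theory Defs
  imports Main "HOL-Library.Product_Lexorder"
begin

section \<open>Partitions, skew shapes, cells (French convention, 0-indexed)\<close>

text \<open>A partition is a weakly decreasing list of positive integers.
  A cell (a,b) has column a and row b; rows are indexed from the bottom.\<close>

definition is_partition :: "nat list \<Rightarrow> bool" where
  "is_partition l \<longleftrightarrow> sorted (rev l) \<and> 0 \<notin> set l"

definition cells_of :: "nat list \<Rightarrow> (nat \<times> nat) set" where
  "cells_of l = {(a, b). b < length l \<and> a < l ! b}"

text \<open>A skew shape lam/mu is the set difference of the two diagrams (no translation).\<close>
definition is_skew :: "nat list \<times> nat list \<Rightarrow> bool" where
  "is_skew s \<longleftrightarrow> is_partition (fst s) \<and> is_partition (snd s) \<and>
                  cells_of (snd s) \<subseteq> cells_of (fst s)"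

definition skew_cells :: "nat list \<times> nat list \<Rightarrow> (nat \<times> nat) set" where
  "skew_cells s = cells_of (fst s) - cells_of (snd s)"

definition tcells :: "(nat list \<times> nat list) list \<Rightarrow> (nat \<times> (nat \<times> nat)) set" where
  "tcells ms = {(i, c). i < length ms \<and> c \<in> skew_cells (ms ! i)}"

definition tsize :: "(nat list \<times> nat list) list \<Rightarrow> nat" where
  "tsize ms = card (tcells ms)"

definition is_SYT :: "(nat list \<times> nat list) list \<Rightarrow> (nat \<times> (nat \<times> nat) \<Rightarrow> nat) \<Rightarrow> bool" where
  "is_SYT ms T \<longleftrightarrow>
     bij_betw T (tcells ms) {1..tsize ms} \<and>
     (\<forall>x. x \<notin> tcells ms \<longrightarrow> T x = 0) \<and>
     (\<forall>i a b. (i, (a, b)) \<in> tcells ms \<and> (i, (Suc a, b)) \<in> tcells ms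
        \<longrightarrow> T (i, (a, b)) < T (i, (Suc a, b))) \<and>
     (\<forall>i a b. (i, (a, b)) \<in> tcells ms \<and> (i, (a, Suc b)) \<in> tcells ms
        \<longrightarrow> T (i, (a, b)) < T (i, (a, Suc b)))"

definition SYT :: "(nat list \<times> nat list) list \<Rightarrow> (nat \<times> (nat \<times> nat) \<Rightarrow> nat) set" where
  "SYT ms = {T. is_SYT ms T}"

primrec index :: "'a list \<Rightarrow> 'a \<Rightarrow> nat" where
  "index [] v = 0"
| "index (x # xs) v = (if x = v then 0 else Suc (index xs v))"

definition content :: "nat \<times> nat \<Rightarrow> int" where
  "content c = int (fst c) - int (snd c)"

definition scont :: "nat \<Rightarrow> nat \<times> (nat \<times> nat) \<Rightarrow> int" where
  "scont k x = int k * content (snd x) + int (fst x)"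

text \<open>Cells listed in increasing shifted content; equal shifted content (same component,
  same diagonal) read southwest to northeast, i.e. by increasing column.\<close>
definition cell_list :: "(nat list \<times> nat list) list \<Rightarrow> (nat \<times> (nat \<times> nat)) list" where
  "cell_list ms = map snd (sorted_list_of_set
       ((\<lambda>x. ((scont (length ms) x, fst (snd x)), x)) ` tcells ms))"

definition reading_word ::
  "(nat list \<times> nat list) list \<Rightarrow> (nat \<times> (nat \<times> nat) \<Rightarrow> nat) \<Rightarrow> nat list" where
  "reading_word ms T = map T (cell_list ms)"

text \<open>Des(T) = {j : sigma(T)_j = -1}, i.e. j+1 lies left of j in the reading word.\<close>
definition des :: "(nat list \<times> nat list) list \<Rightarrow> (nat \<times> (nat \<times> nat) \<Rightarrow> nat) \<Rightarrow> nat set" where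
  "des ms T = (let w = reading_word ms T in
      {j. 1 \<le> j \<and> j < tsize ms \<and> index w (Suc j) < index w j})"

definition between :: "nat list \<Rightarrow> nat \<Rightarrow> bool" where
  "between w i \<longleftrightarrow>
     (index w (i - 1) < index w i \<and> index w i < index w (i + 1)) \<or>
     (index w (i + 1) < index w i \<and> index w i < index w (i - 1))"

definition swap_vals :: "nat \<Rightarrow> nat \<Rightarrow> nat list \<Rightarrow> nat list" where
  "swap_vals x y w = map (\<lambda>v. if v = x then y else if v = y then x else v) w"

definition d_op :: "nat \<Rightarrow> nat list \<Rightarrow> nat list" where
  "d_op i w = (if between w i then w else
     (let pd = (\<lambda>v. \<bar>int (index w i) - int (index w v)\<bar>);
          j = (if pd (i - 1) > pd (i + 1) then i - 1 else i + 1)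
      in swap_vals i j w))"

definition dt_op :: "nat \<Rightarrow> nat list \<Rightarrow> nat list" where
  "dt_op i w = (if between w i then w else
     (let vs = sort_key (index w) [i - 1, i, i + 1];
          a = vs ! 0; b = vs ! 1; c = vs ! 2;
          f = (if a = i then (\<lambda>v. if v = a then b else if v = b then c else if v = c then a else v)
               else (\<lambda>v. if v = a then c else if v = b then a else if v = c then b else v))
      in map f w))"

definition D_op :: "(nat list \<times> nat list) list \<Rightarrow> nat \<Rightarrow>
    (nat \<times> (nat \<times> nat) \<Rightarrow> nat) \<Rightarrow> (nat \<times> (nat \<times> nat) \<Rightarrow> nat)" where
  "D_op ms i T = (let cl = cell_list ms; w = reading_word ms T; k = length ms;
       e = (\<lambda>v. scont k (cl ! index w v));
       sc3 = {e (i - 1), e i, e (i + 1)};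
       dd = Max sc3 - Min sc3;
       w' = (if dd > int k then d_op i w else dt_op i w)
     in (\<lambda>x. if x \<in> set cl then w' ! index cl x else 0))"

text \<open>Formal power series in variables x_0, x_1, ... are identified with their coefficient
  functions on monomials; a monomial is an exponent vector a :: nat => nat.\<close>

definition Q_coeff :: "nat \<Rightarrow> nat set \<Rightarrow> (nat \<Rightarrow> nat) \<Rightarrow> nat" where
  "Q_coeff m D a = card {s :: nat list. length s = m \<and> sorted s \<and>
      (\<forall>j \<in> D. 1 \<le> j \<and> j < m \<longrightarrow> s ! (j - 1) < s ! j) \<and>
      (\<forall>v. count_list s v = a v)}"

definition schur_coeff :: "nat list \<Rightarrow> (nat \<Rightarrow> nat) \<Rightarrow> nat" where
  "schur_coeff lam a = card {T :: nat \<times> nat \<Rightarrow> nat.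
      (\<forall>x. x \<notin> cells_of lam \<longrightarrow> T x = 0) \<and>
      (\<forall>p q. (p, q) \<in> cells_of lam \<and> (Suc p, q) \<in> cells_of lam \<longrightarrow> T (p, q) \<le> T (Suc p, q)) \<and>
      (\<forall>p q. (p, q) \<in> cells_of lam \<and> (p, Suc q) \<in> cells_of lam \<longrightarrow> T (p, q) < T (p, Suc q)) \<and>
      (\<forall>v. card {x \<in> cells_of lam. T x = v} = a v)}"

definition partitions_of :: "nat \<Rightarrow> nat list set" where
  "partitions_of m = {l. is_partition l \<and> sum_list l = m}"

definition schur_positive :: "nat \<Rightarrow> ((nat \<Rightarrow> nat) \<Rightarrow> nat) \<Rightarrow> bool" where
  "schur_positive m f \<longleftrightarrow> (\<exists>c :: nat list \<Rightarrow> nat.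
      \<forall>a. f a = (\<Sum>lam \<in> partitions_of m. c lam * schur_coeff lam a))"

definition single_schur :: "nat \<Rightarrow> ((nat \<Rightarrow> nat) \<Rightarrow> nat) \<Rightarrow> bool" where
  "single_schur m f \<longleftrightarrow> (\<exists>lam \<in> partitions_of m. \<forall>a. f a = schur_coeff lam a)"

definition deq_class :: "'t set \<Rightarrow> (nat \<Rightarrow> 't \<Rightarrow> 't) \<Rightarrow> nat \<Rightarrow> nat \<Rightarrow> 't \<Rightarrow> 't set" where
  "deq_class A phi h i T =
     (let R = {(U, phi j U) | U j. U \<in> A \<and> h \<le> j \<and> j \<le> i}
      in {U. (T, U) \<in> (R \<union> R\<inverse>)\<^sup>*})"

definition des_hi :: "('t \<Rightarrow> nat set) \<Rightarrow> nat \<Rightarrow> nat \<Rightarrow> 't \<Rightarrow> nat set" where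
  "des_hi Des h i U = (\<lambda>d. d - (h - 2)) ` (Des U \<inter> {h - 1..i})"

definition qs_sum :: "'t set \<Rightarrow> ('t \<Rightarrow> nat set) \<Rightarrow> (nat \<Rightarrow> 't \<Rightarrow> 't) \<Rightarrow> nat \<Rightarrow> nat \<Rightarrow> 't
    \<Rightarrow> (nat \<Rightarrow> nat) \<Rightarrow> nat" where
  "qs_sum A Des phi h i T a =
     (\<Sum>U \<in> deq_class A phi h i T. Q_coeff (i - h + 3) (des_hi Des h i U) a)"

definition weak_dual_equivalence ::
  "'t set \<Rightarrow> ('t \<Rightarrow> nat set) \<Rightarrow> nat \<Rightarrow> (nat \<Rightarrow> 't \<Rightarrow> 't) \<Rightarrow> bool" where
  "weak_dual_equivalence A Des n phi \<longleftrightarrow>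
     finite A \<and>
     (\<forall>i. 1 < i \<and> i < n \<longrightarrow> (\<forall>T \<in> A. phi i T \<in> A \<and> phi i (phi i T) = T)) \<and>
     (\<forall>h i T. 1 < h \<and> h \<le> i \<and> i < n \<and> i - h \<le> 3 \<and> T \<in> A \<longrightarrow>
        schur_positive (i - h + 3) (qs_sum A Des phi h i T) \<and>
        (h = i \<longrightarrow> single_schur (i - h + 3) (qs_sum A Des phi h i T))) \<and>
     (\<forall>i j. 1 < i \<and> i < n \<and> 1 < j \<and> j < n \<and> (i + 3 \<le> j \<or> j + 3 \<le> i) \<longrightarrow>
        (\<forall>T \<in> A. phi i (phi j T) = phi j (phi i T)))"

definition dual_equivalence ::
  "'t set \<Rightarrow> ('t \<Rightarrow> nat set) \<Rightarrow> nat \<Rightarrow> (nat \<Rightarrow> 't \<Rightarrow> 't) \<Rightarrow> bool" where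
  "dual_equivalence A Des n phi \<longleftrightarrow>
     weak_dual_equivalence A Des n phi \<and>
     (\<forall>h i T. 1 < h \<and> h \<le> i \<and> i < n \<and> i - h \<le> 3 \<and> T \<in> A \<longrightarrow>
        single_schur (i - h + 3) (qs_sum A Des phi h i T))"

end

theory Submission
  imports Defs
begin

text \<open>
  Record a tableau by the list of its cells in order of their entries, each cell represented by its
  position in the content reading order. Then \<open>D\<^sub>i\<close> becomes a local move on three consecutive letters
  with values \<open>x < y < z\<close>: a Knuth move \<open>yxz ~ yzx\<close>, \<open>xzy ~ zxy\<close> if the shifted contents of \<open>x\<close> and \<open>z\<close>
  differ by more than \<open>k\<close>, and a rotation \<open>yxz ~ xzy\<close>, \<open>zxy ~ yzx\<close> otherwise, while descents of the
  tableau become descents of the word. Hence a class \<open>[T]\<^bsub>h,i\<^esub>\<close> is the class of a word with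
  \<open>m = i - h + 3 \<le> 6\<close> distinct letters and depends only on that word up to standardisation and on which
  pairs of letters are far apart, a monotone relation with 42 possibilities. For all of them
  the classes are enumerated and their descent multisets are split into those of the standard tableaux
  of partitions of \<open>m\<close>.

  The same enumeration shows that a class whose expansion has more than one term contains a word in
  which, for some four consecutive letters that are pairwise close, no two neighbouring ones occur at
  distance at least 3 in increasing order. For \<open>k \<le> 2\<close> this is impossible: by pigeonhole
  two neighbouring letters among the four have the same shifted content, so they lie on one diagonal of
  one component, and the entries of such cells differ by at least 3.
\<close>

section \<open>Words and elementary moves\<close>

text \<open>\<open>a\<close>, \<open>b\<close>, \<open>c\<close> are the positions of the cells
  carrying three consecutive entries, so that moving entries permutes the triple. The triple changes
  only if \<open>b\<close> is an extreme, and \<open>F\<close> is always asked about its minimum and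
  its maximum, in this order.\<close>

definition move3 :: "('a::linorder \<Rightarrow> 'a \<Rightarrow> bool) \<Rightarrow> 'a \<Rightarrow> 'a \<Rightarrow> 'a \<Rightarrow> 'a list" where
  "move3 F a b c =
    (if a < b \<and> c < b then
       if a < c then if F a b then [b, a, c] else [c, a, b]
       else if F c b then [a, c, b] else [b, c, a]
     else if b < a \<and> b < c then
       if a < c then if F b c then [a, c, b] else [b, c, a]
       else if F b a then [b, a, c] else [c, a, b]
     else [a, b, c])"

definition act :: "('a::linorder \<Rightarrow> 'a \<Rightarrow> bool) \<Rightarrow> nat \<Rightarrow> 'a list \<Rightarrow> 'a list" where
  "act F j u = take j u @ move3 F (u ! j) (u ! Suc j) (u ! Suc (Suc j)) @ drop (j + 3) u"

definition step :: "('a::linorder \<Rightarrow> 'a \<Rightarrow> bool) \<Rightarrow> 'a list \<Rightarrow> 'a list \<Rightarrow> bool" where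
  "step F u v \<longleftrightarrow> (\<exists>j. j + 2 < length u \<and> v = act F j u)"

definition reach :: "('a::linorder \<Rightarrow> 'a \<Rightarrow> bool) \<Rightarrow> 'a list \<Rightarrow> 'a list set" where
  "reach F u = {v. (step F)\<^sup>*\<^sup>* u v}"

lemma set_move3: "set (move3 F a b c) = {a, b, c}"
  by (auto simp: move3_def)

lemma length_move3 [simp]: "length (move3 F a b c) = 3"
  by (auto simp: move3_def)

lemma distinct_move3: "distinct [a, b, c] \<Longrightarrow> distinct (move3 F a b c)"
  by (auto simp: move3_def)

lemma split_triple:
  assumes "j + 2 < length u"
  shows "u = take j u @ [u ! j, u ! Suc j, u ! Suc (Suc j)] @ drop (j + 3) u"
proof -
  have "drop j u = u ! j # u ! Suc j # u ! Suc (Suc j) # drop (j + 3) u"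
    using assms by (simp add: Cons_nth_drop_Suc numeral_3_eq_3)
  then show ?thesis by (metis append_Cons append_Nil append_take_drop_id)
qed

lemma act_append: "act F (length p) (p @ [a, b, c] @ q) = p @ move3 F a b c @ q"
  by (simp add: act_def nth_append)

lemma act_Cons: "act F (Suc j) (a # u) = a # act F j u"
  by (simp add: act_def numeral_3_eq_3)

lemma act_0: "act F 0 (a # b # c # u) = move3 F a b c @ u"
  by (simp add: act_def numeral_3_eq_3)

lemma tripleE:
  assumes "j + 2 < length u"
  obtains p a b c q where "u = p @ [a, b, c] @ q" "length p = j" "act F j u = p @ move3 F a b c @ q"
proof
  show "u = take j u @ [u ! j, u ! Suc j, u ! Suc (Suc j)] @ drop (j + 3) u"
    using split_triple[OF assms] .
  show "length (take j u) = j" using assms by simp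
  show "act F j u = take j u @ move3 F (u ! j) (u ! Suc j) (u ! Suc (Suc j)) @ drop (j + 3) u"
    by (simp add: act_def)
qed

lemma set_act: assumes "j + 2 < length u" shows "set (act F j u) = set u"
  by (rule tripleE[OF assms, where F = F]) (auto simp: set_move3)

lemma length_act [simp]: assumes "j + 2 < length u" shows "length (act F j u) = length u"
  by (rule tripleE[OF assms, where F = F]) auto

lemma distinct_act: assumes "j + 2 < length u" "distinct u" shows "distinct (act F j u)"
  by (rule tripleE[OF assms(1), where F = F])
     (use assms(2) distinct_move3 in \<open>auto simp: set_move3\<close>)

text \<open>A changed triple again has an extreme letter in the middle, with the same minimum and
  maximum. So \<open>F\<close> gives the same answer, and the same kind of move leads back.\<close>

lemma move3_move3:
  assumes "distinct [a, b, c]" "move3 F a b c = [a', b', c']"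
  shows "move3 F a' b' c' = [a, b, c]"
  using assms by (auto simp: move3_def split: if_splits)

lemma act_act:
  assumes "j + 2 < length u" "distinct u"
  shows "act F j (act F j u) = u"
proof (rule tripleE[OF assms(1), where F = F])
  fix p a b c q
  assume u: "u = p @ [a, b, c] @ q" "length p = j" and e: "act F j u = p @ move3 F a b c @ q"
  obtain a' b' c' where m: "move3 F a b c = [a', b', c']"
    using length_move3[of F a b c] unfolding numeral_3_eq_3 length_Suc_conv by auto
  have "move3 F a' b' c' = [a, b, c]"
    by (rule move3_move3[OF _ m]) (use assms(2) u in auto)
  then show ?thesis
    using act_append[of F p a' b' c' q] e u m by simp
qed

lemma act_inside:
  assumes "j + 2 < length v"
  shows "act F (length p + j) (p @ v @ q) = p @ act F j v @ q"
proof (rule tripleE[OF assms, where F = F])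
  fix p' a b c q'
  assume v: "v = p' @ [a, b, c] @ q'" "length p' = j" and e: "act F j v = p' @ move3 F a b c @ q'"
  show ?thesis using act_append[of F "p @ p'" a b c "q' @ q"] e v by simp
qed

text \<open>The windows at \<open>i\<close> and \<open>j\<close> are disjoint: splitting
  \<open>u\<close> at place \<open>j\<close> puts each into its own factor.\<close>

lemma act_commute:
  assumes "i + 2 < j" "j + 2 < length u"
  shows "act F i (act F j u) = act F j (act F i u)"
proof -
  obtain p v where u: "u = p @ v" and p: "length p = j"
    using assms(2) by (metis append_take_drop_id length_take min.absorb2 add_lessD1 less_imp_le)
  have v: "2 < length v" using u p assms by simp
  have 1: "act F j (x @ v) = x @ act F 0 v" if "length x = j" for x
    using act_inside[of 0 v F x "[]"] v that by simp
  have 2: "act F i (p @ x) = act F i p @ x" for x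
    using act_inside[of i p F "[]" x] p assms(1) by simp
  have "length (act F i p) = j" using assms(1) p by simp
  then show ?thesis by (simp add: u 1 2 p)
qed

section \<open>Classes of words under the moves\<close>

lemma reach_refl: "u \<in> reach F u"
  by (simp add: reach_def)

lemma reach_step: "v \<in> reach F u \<Longrightarrow> j + 2 < length v \<Longrightarrow> act F j v \<in> reach F u"
  unfolding reach_def step_def by (auto intro: rtranclp.rtrancl_into_rtrancl)

lemma reach_induct [consumes 1, case_names refl step]:
  assumes "v \<in> reach F u" "P u"
    and "\<And>v j. v \<in> reach F u \<Longrightarrow> P v \<Longrightarrow> j + 2 < length v \<Longrightarrow> P (act F j v)"
  shows "P v"
proof -
  have "(step F)\<^sup>*\<^sup>* u v" using assms(1) by (simp add: reach_def)
  then show ?thesis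
  proof induction
    case base then show ?case using assms(2) .
  next
    case (step y z)
    then show ?case using assms(3)[of y] by (auto simp: reach_def step_def)
  qed
qed

lemma reach_perm:
  assumes "v \<in> reach F u" "distinct u"
  shows "distinct v \<and> set v = set u \<and> length v = length u"
  using assms(1) by (induction rule: reach_induct) (auto simp: assms set_act distinct_act)

lemma reach_trans: "v \<in> reach F u \<Longrightarrow> w \<in> reach F v \<Longrightarrow> w \<in> reach F u"
  by (auto simp: reach_def)

lemma reach_sym:
  assumes "v \<in> reach F u" "distinct u" shows "u \<in> reach F v"
  using assms(1)
proof (induction rule: reach_induct)
  case refl then show ?case by (rule reach_refl)
next
  case (step v j)
  have "act F j (act F j v) = v" using act_act step reach_perm[OF step(1) assms(2)] by blast
  then have "v \<in> reach F (act F j v)"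
    using reach_step[OF reach_refl, of j "act F j v" F] step by simp
  then show ?case using reach_trans step by blast
qed

lemma reach_eq:
  assumes "v \<in> reach F u" "distinct u" shows "reach F v = reach F u"
  using assms reach_sym reach_trans by blast

text \<open>\<open>F\<close> and \<open>G\<close> have to agree only on pairs with a third letter of
  the triple strictly in between, because a move compares nothing but the extremes. This lets ten
  booleans describe farness on six letters.\<close>

lemma move3_map:
  assumes "\<And>x y. x \<in> {a, b, c} \<Longrightarrow> y \<in> {a, b, c} \<Longrightarrow> g x < g y \<longleftrightarrow> x < y"
    and "\<And>x y z. {x, y, z} \<subseteq> {a, b, c} \<Longrightarrow> x < z \<Longrightarrow> z < y \<Longrightarrow> F (g x) (g y) = G x y"
    and "distinct [a, b, c]"
  shows "move3 F (g a) (g b) (g c) = map g (move3 G a b c)"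
proof -
  have lt: "g a < g b \<longleftrightarrow> a < b" "g b < g a \<longleftrightarrow> b < a" "g b < g c \<longleftrightarrow> b < c" "g c < g b \<longleftrightarrow> c < b"
    "g a < g c \<longleftrightarrow> a < c" "g c < g a \<longleftrightarrow> c < a"
    using assms(1) by auto
  consider "a < b" "c < b" "a < c" | "a < b" "c < b" "c < a" | "b < a" "b < c" "a < c"
    | "b < a" "b < c" "c < a" | "\<not> (a < b \<and> c < b)" "\<not> (b < a \<and> b < c)"
    using assms(3) by fastforce
  then show ?thesis
  proof cases
    case 1 then show ?thesis using assms(2)[of a b c] by (simp add: move3_def lt)
  next
    case 2 then show ?thesis using assms(2)[of c b a] by (auto simp add: move3_def lt)
  next
    case 3 then show ?thesis using assms(2)[of b c a] by (auto simp add: move3_def lt)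
  next
    case 4 then show ?thesis using assms(2)[of b a c] by (auto simp add: move3_def lt)
  next
    case 5 then show ?thesis by (auto simp add: move3_def lt)
  qed
qed

lemma act_map:
  assumes "\<And>x y. x \<in> set v \<Longrightarrow> y \<in> set v \<Longrightarrow> g x < g y \<longleftrightarrow> x < y"
    and "\<And>x y z. {x, y, z} \<subseteq> set v \<Longrightarrow> x < z \<Longrightarrow> z < y \<Longrightarrow> F (g x) (g y) = G x y"
    and "distinct v" "j + 2 < length v"
  shows "act F j (map g v) = map g (act G j v)"
proof (rule tripleE[OF assms(4), where F = G])
  fix p a b c q
  assume v: "v = p @ [a, b, c] @ q" "length p = j" and e: "act G j v = p @ move3 G a b c @ q"
  have "move3 F (g a) (g b) (g c) = map g (move3 G a b c)"
    using assms(3) v(1) by (intro move3_map assms(1,2)) auto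
  then show ?thesis using act_append[of F "map g p" "g a" "g b" "g c" "map g q"] e v by simp
qed

text \<open>A class thus depends only on the standardisation of the word and on the farness of its
  letters, which leaves finitely many cases for each length.\<close>

lemma reach_map:
  assumes mono: "\<And>x y. x \<in> set v \<Longrightarrow> y \<in> set v \<Longrightarrow> g x < g y \<longleftrightarrow> x < y"
    and F: "\<And>x y z. {x, y, z} \<subseteq> set v \<Longrightarrow> x < z \<Longrightarrow> z < y \<Longrightarrow> F (g x) (g y) = G x y"
    and d: "distinct v"
  shows "reach F (map g v) = map g ` reach G v"
proof (intro equalityI subsetI)
  have am: "act F j (map g w) = map g (act G j w)" if "w \<in> reach G v" "j + 2 < length w" for w j
    using reach_perm[OF that(1) d] that(2) by (intro act_map mono F) auto
  fix x assume "x \<in> reach F (map g v)"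
  then show "x \<in> map g ` reach G v"
  proof (induction rule: reach_induct)
    case refl then show ?case by (auto intro: reach_refl)
  next
    case (step x j)
    then obtain w where w: "w \<in> reach G v" "x = map g w" by auto
    with step.hyps show ?case using am[of w j] reach_step[of w G v j] by (auto intro!: imageI)
  qed
next
  have am: "act F j (map g w) = map g (act G j w)" if "w \<in> reach G v" "j + 2 < length w" for w j
    using reach_perm[OF that(1) d] that(2) by (intro act_map mono F) auto
  fix x assume "x \<in> map g ` reach G v"
  then obtain w where w: "w \<in> reach G v" "x = map g w" by auto
  from w(1) have "map g w \<in> reach F (map g v)"
  proof (induction rule: reach_induct)
    case refl then show ?case by (rule reach_refl)
  next
    case (step w j)
    then show ?case using am[of w j] reach_step[of "map g w" F "map g v" j] by auto
  qed
  then show "x \<in> reach F (map g v)" using w by simp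
qed

text \<open>The relation is a parameter because the same function serves words, with
  \<open><\<close>, and tableaux, with \<open>cell_less\<close>. As boolean lists, the descent sets
  of both can be compared by evaluation.\<close>

fun descents :: "('a \<Rightarrow> 'a \<Rightarrow> bool) \<Rightarrow> 'a list \<Rightarrow> bool list" where
  "descents R (a # b # u) = R b a # descents R (b # u)"
| "descents R _ = []"

abbreviation word_descents :: "'a::ord list \<Rightarrow> bool list" where
  "word_descents \<equiv> descents (<)"

definition descent_positions :: "bool list \<Rightarrow> nat set" where
  "descent_positions bs = {Suc j |j. j < length bs \<and> bs ! j}"

lemma length_descents: "length (descents R u) = length u - 1"
  by (induction R u rule: descents.induct) auto

lemma nth_descents: "Suc j < length u \<Longrightarrow> descents R u ! j \<longleftrightarrow> R (u ! Suc j) (u ! j)"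
  by (induction R u arbitrary: j rule: descents.induct) (auto simp: nth_Cons split: nat.splits)

lemma descent_positions_descents: "descent_positions (descents R u) = {Suc j |j. Suc j < length u \<and> R (u ! Suc j) (u ! j)}"
  unfolding descent_positions_def length_descents using nth_descents[of _ u R] by fastforce

lemma word_descents_map:
  assumes "\<And>x y. x \<in> set v \<Longrightarrow> y \<in> set v \<Longrightarrow> g x < g y \<longleftrightarrow> x < y"
  shows "word_descents (map g v) = word_descents v"
  using assms by (induction v rule: induct_list012) auto

section \<open>Schur functions as sums over linear extensions\<close>

fun cells :: "nat \<Rightarrow> nat list \<Rightarrow> (nat \<times> nat) list" where
  "cells q [] = []"
| "cells q (a # l) = map (\<lambda>p. (p, q)) [0..<a] @ cells (Suc q) l"

definition cell_covers :: "nat \<times> nat \<Rightarrow> nat \<times> nat \<Rightarrow> bool" where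
  "cell_covers x y \<longleftrightarrow> y = (Suc (fst x), snd x) \<or> y = (fst x, Suc (snd x))"

text \<open>The comparison of contents, stated without subtraction so that it can be evaluated on \<open>nat\<close>.\<close>
definition cell_less :: "nat \<times> nat \<Rightarrow> nat \<times> nat \<Rightarrow> bool" where
  "cell_less x y \<longleftrightarrow> fst x + snd y < fst y + snd x"

function linexts :: "(nat \<times> nat) list \<Rightarrow> (nat \<times> nat) list list" where
  "linexts xs = (if xs = [] then [[]]
     else concat (map (\<lambda>x. if x \<in> set xs then map ((#) x) (linexts (remove1 x xs)) else [])
       (filter (\<lambda>x. \<not> list_ex (\<lambda>y. cell_covers y x) xs) xs)))"
  by auto
termination
  by (relation "measure length") (auto simp: length_remove1 dest: length_pos_if_in_set)

declare linexts.simps [simp del]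

text \<open>For a diagram \<open>A\<close> these are its standard tableaux, each written as the list
  of cells in order of their entries.\<close>

definition linear_extensions :: "(nat \<times> nat) set \<Rightarrow> (nat \<times> nat) list set" where
  "linear_extensions A = {u. distinct u \<and> set u = A \<and> sorted_wrt (\<lambda>x y. \<not> cell_covers y x) u}"

lemma cell_covers_irrefl [simp]: "\<not> cell_covers x x"
  by (cases x) (simp add: cell_covers_def)

lemma cell_less_content: "cell_less x y \<longleftrightarrow> content x < content y"
  by (auto simp: cell_less_def content_def)

lemma set_cells: "set (cells q l) = {(a, b). q \<le> b \<and> b < q + length l \<and> a < l ! (b - q)}"
proof (induction l arbitrary: q)
  case (Cons x l)
  have "(a, b) \<in> set (cells q (x # l)) \<longleftrightarrow> q \<le> b \<and> b < q + length (x # l) \<and> a < (x # l) ! (b - q)" for a b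
  proof (cases "b = q")
    case True then show ?thesis by (auto simp: Cons)
  next
    case False
    have "b - q = Suc (b - Suc q)" if "q \<le> b" using that False by simp
    then show ?thesis using False by (cases "q \<le> b") (auto simp: Cons)
  qed
  then show ?case by auto
qed auto

lemma set_cells_0: "set (cells 0 l) = cells_of l"
  by (auto simp: set_cells cells_of_def)

lemma distinct_cells: "distinct (cells q l)"
  by (induction l arbitrary: q) (auto simp: distinct_map inj_on_def set_cells)

lemma length_cells: "length (cells q l) = sum_list l"
  by (induction l arbitrary: q) auto

lemma card_cells_of: "finite (cells_of l)" "card (cells_of l) = sum_list l"
  using set_cells_0[of l] distinct_card[OF distinct_cells[of 0 l]] length_cells[of 0 l]
  by (metis List.finite_set, metis)

lemma set_linexts: "distinct xs \<Longrightarrow> set (linexts xs) = linear_extensions (set xs)"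
proof (induction xs rule: linexts.induct)
  case (1 xs)
  show ?case
  proof (cases "xs = []")
    case True then show ?thesis by (subst linexts.simps) (auto simp: linear_extensions_def)
  next
    case False
    have "set (linexts xs) = {x # v |x v. x \<in> set xs \<and> (\<forall>y \<in> set xs. \<not> cell_covers y x)
        \<and> v \<in> linear_extensions (set xs - {x})}"
      using 1 False by (subst linexts.simps) (auto simp: list_ex_iff)
    also have "\<dots> = linear_extensions (set xs)"
    proof (intro equalityI subsetI)
      fix u assume "u \<in> {x # v |x v. x \<in> set xs \<and> (\<forall>y \<in> set xs. \<not> cell_covers y x)
        \<and> v \<in> linear_extensions (set xs - {x})}"
      then show "u \<in> linear_extensions (set xs)" by (auto simp: linear_extensions_def)
    next
      fix u assume u: "u \<in> linear_extensions (set xs)"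
      with False obtain x v where "u = x # v" by (cases u) (auto simp: linear_extensions_def)
      moreover from this have xs: "set xs = insert x (set v)" and "\<forall>y \<in> set v. \<not> cell_covers y x" "x \<notin> set v"
        using u by (simp_all add: linear_extensions_def)
      then have "x \<in> set xs" "\<forall>y \<in> set xs. \<not> cell_covers y x" "set v = set xs - {x}"
        by simp_all
      moreover from this have "v \<in> linear_extensions (set xs - {x})"
        using u \<open>u = x # v\<close> by (simp add: linear_extensions_def)
      ultimately show "u \<in> {x # v |x v. x \<in> set xs \<and> (\<forall>y \<in> set xs. \<not> cell_covers y x)
        \<and> v \<in> linear_extensions (set xs - {x})}"
        by blast
    qed
    finally show ?thesis .
  qed
qed

lemma distinct_linexts: "distinct xs \<Longrightarrow> distinct (linexts xs)"
proof (induction xs rule: linexts.induct)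
  case (1 xs)
  show ?case
  proof (cases "xs = []")
    case True then show ?thesis by (subst linexts.simps) simp
  next
    case False
    let ?ys = "filter (\<lambda>x. \<not> list_ex (\<lambda>y. cell_covers y x) xs) xs"
    have "distinct (linexts (remove1 x xs))" if "x \<in> set ?ys" for x
      using "1.IH"[OF False that] "1.prems" that by simp
    then have "distinct (map ((#) x) (linexts (remove1 x xs)))" if "x \<in> set ?ys" for x
      using that by (simp add: distinct_map)
    then have "distinct (concat (map (\<lambda>x. map ((#) x) (linexts (remove1 x xs))) ys))"
      if "distinct ys" "set ys \<subseteq> set ?ys" for ys
      using that by (induction ys) auto
    from this[of ?ys] have "distinct (concat (map (\<lambda>x. map ((#) x) (linexts (remove1 x xs))) ?ys))"
      using "1.prems" by simp
    moreover have "map (\<lambda>x. if x \<in> set xs then map ((#) x) (linexts (remove1 x xs)) else []) ?ys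
        = map (\<lambda>x. map ((#) x) (linexts (remove1 x xs))) ?ys"
      by (rule map_cong) auto
    ultimately show ?thesis using False by (subst linexts.simps) (simp only: if_False)
  qed
qed

lemma index_less: "x \<in> set u \<Longrightarrow> index u x < length u"
  by (induction u) auto

lemma nth_index: "x \<in> set u \<Longrightarrow> u ! index u x = x"
  by (induction u) auto

lemma index_nth: "distinct u \<Longrightarrow> i < length u \<Longrightarrow> index u (u ! i) = i"
  by (induction u arbitrary: i) (auto simp: nth_Cons split: nat.splits)

lemma index_sorted_wrt:
  assumes "sorted_wrt (\<lambda>x y. \<not> R y x) u" "x \<in> set u" "y \<in> set u" "R x y" "x \<noteq> y"
  shows "index u x < index u y"
proof (rule ccontr)
  assume "\<not> index u x < index u y"
  moreover have "index u x \<noteq> index u y" using nth_index[of x u] nth_index[of y u] assms by metis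
  ultimately have "index u y < index u x" by simp
  then have "\<not> R (u ! index u x) (u ! index u y)"
    using assms(1) index_less[OF assms(2)] by (auto simp: sorted_wrt_iff_nth_less)
  then show False using assms nth_index by metis
qed

lemma cells_of_down:
  assumes "is_partition l" "(a, b) \<in> cells_of l" "a' \<le> a" "b' \<le> b"
  shows "(a', b') \<in> cells_of l"
proof -
  have "sorted_wrt (\<ge>) l" using assms(1) by (simp add: is_partition_def sorted_wrt_rev)
  then have "l ! b \<le> l ! b'"
    using assms(2,4) by (cases "b = b'") (auto simp: cells_of_def sorted_wrt_iff_nth_less)
  then show ?thesis using assms by (auto simp: cells_of_def)
qed

text \<open>\<open>linear_extensions\<close> constrains covers only. The diagram of a partition is
  closed downwards, so \<open>(p', q')\<close> is reached from \<open>(p, q)\<close> by unit steps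
  inside it; hence the induction on \<open>p + q\<close>.\<close>

lemma linear_extension_mono:
  assumes l: "is_partition l" and u: "u \<in> linear_extensions (cells_of l)"
  shows "(p, q) \<in> cells_of l \<Longrightarrow> p' \<le> p \<Longrightarrow> q' \<le> q \<Longrightarrow> (p', q') \<noteq> (p, q) \<Longrightarrow>
    index u (p', q') < index u (p, q)"
proof (induction "p + q" arbitrary: p q)
  case (Suc n)
  have ix: "index u x < index u y" if "cell_covers x y" "x \<in> cells_of l" "y \<in> cells_of l" for x y
    using u that by (intro index_sorted_wrt[of cell_covers]) (auto simp: linear_extensions_def)
  show ?case
  proof (cases "p' < p")
    case True
    then obtain p0 where p: "p = Suc p0" by (cases p) auto
    have "(p0, q) \<in> cells_of l" using cells_of_down[OF l Suc.prems(1), of p0 q] p by simp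
    moreover from this have "index u (p0, q) < index u (p, q)"
      using p Suc.prems(1) by (intro ix) (auto simp: cell_covers_def)
    ultimately show ?thesis using Suc.hyps(1)[of p0 q] Suc.hyps(2) Suc.prems p True
      by (cases "(p', q') = (p0, q)") auto
  next
    case False
    with Suc.prems have "q' < q" "p' = p" by auto
    then obtain q0 where q: "q = Suc q0" by (cases q) auto
    have "(p, q0) \<in> cells_of l" using cells_of_down[OF l Suc.prems(1), of p q0] q by simp
    moreover from this have "index u (p, q0) < index u (p, q)"
      using q Suc.prems(1) by (intro ix) (auto simp: cell_covers_def)
    ultimately show ?thesis using Suc.hyps(1)[of p q0] Suc.hyps(2) Suc.prems q \<open>q' < q\<close>
      by (cases "(p', q') = (p, q0)") auto
  qed
qed auto

section \<open>Compatible sequences and semistandard fillings\<close>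

definition compatible :: "nat \<Rightarrow> nat set \<Rightarrow> (nat \<Rightarrow> nat) \<Rightarrow> nat list set" where
  "compatible m D a = {s. length s = m \<and> sorted s \<and>
      (\<forall>j \<in> D. 1 \<le> j \<and> j < m \<longrightarrow> s ! (j - 1) < s ! j) \<and> (\<forall>v. count_list s v = a v)}"

text \<open>The exponent vector \<open>a\<close> fixes which values occur, so all members use the
  values of any one of them.\<close>

lemma finite_compatible: "finite (compatible m D a)"
proof (cases "compatible m D a = {}")
  case False
  then obtain s0 where s0: "s0 \<in> compatible m D a" by auto
  have "compatible m D a \<subseteq> {s. set s \<subseteq> set s0 \<and> length s = m}"
  proof
    fix s assume "s \<in> compatible m D a"
    then have "count_list s v = count_list s0 v" for v using s0 by (simp add: compatible_def)
    then have "set s \<subseteq> set s0" by (metis count_list_0_iff subsetI)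
    then show "s \<in> {s. set s \<subseteq> set s0 \<and> length s = m}" using \<open>s \<in> _\<close> by (simp add: compatible_def)
  qed
  then show ?thesis using finite_lists_length_eq[of "set s0" m] finite_subset by auto
qed simp

definition fillings :: "nat list \<Rightarrow> (nat \<Rightarrow> nat) \<Rightarrow> (nat \<times> nat \<Rightarrow> nat) set" where
  "fillings lam a = {T.
      (\<forall>x. x \<notin> cells_of lam \<longrightarrow> T x = 0) \<and>
      (\<forall>p q. (p, q) \<in> cells_of lam \<and> (Suc p, q) \<in> cells_of lam \<longrightarrow> T (p, q) \<le> T (Suc p, q)) \<and>
      (\<forall>p q. (p, q) \<in> cells_of lam \<and> (p, Suc q) \<in> cells_of lam \<longrightarrow> T (p, q) < T (p, Suc q)) \<and>
      (\<forall>v. card {x \<in> cells_of lam. T x = v} = a v)}"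

text \<open>A semistandard filling is standardised by listing its cells by increasing entry, ties being
  broken by content. On a straight shape the third component never decides.\<close>
definition std_key :: "(nat \<times> nat \<Rightarrow> nat) \<Rightarrow> nat \<times> nat \<Rightarrow> nat \<times> int \<times> nat" where
  "std_key T x = (T x, content x, fst x)"

lemma inj_std_key: "inj (std_key T)"
  by (rule injI) (auto simp: std_key_def content_def prod_eq_iff)

definition fill :: "(nat \<times> nat) list \<times> nat list \<Rightarrow> nat \<times> nat \<Rightarrow> nat" where
  "fill us x = (if x \<in> set (fst us) then snd us ! index (fst us) x else 0)"

lemma card_fill:
  assumes "distinct u" "length s = length u"
  shows "card {x \<in> set u. fill (u, s) x = v} = count_list s v"
proof -
  have "{x \<in> set u. fill (u, s) x = v} = (!) u ` {i. i < length u \<and> s ! i = v}" (is "?A = ?B")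
  proof (intro equalityI subsetI)
    fix x assume "x \<in> ?A"
    then have "index u x < length u" "s ! index u x = v" "x = u ! index u x"
      using index_less[of x u] nth_index[of x u] by (auto simp: fill_def)
    then show "x \<in> ?B" by blast
  next
    fix x assume "x \<in> ?B"
    then show "x \<in> ?A" using index_nth[OF assms(1)] by (auto simp: fill_def)
  qed
  moreover have "inj_on ((!) u) {i. i < length u \<and> s ! i = v}"
    using assms(1) by (auto simp: inj_on_def nth_eq_iff_index_eq)
  ultimately have "card {x \<in> set u. fill (u, s) x = v} = card {i. i < length u \<and> s ! i = v}"
    by (simp add: card_image)
  also have "\<dots> = length (filter (\<lambda>x. x = v) s)" using assms(2) by (simp add: length_filter_conv_card)
  also have "\<dots> = count_list s v" by (induction s) auto
  finally show ?thesis .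
qed

text \<open>Along \<open>u\<close> the entries weakly increase, and strictly at each descent of
  contents. So where an entry is repeated the content does not drop, and cells of equal content lie
  on a diagonal, which every linear extension reads from southwest to northeast.\<close>

lemma std_key_increasing:
  assumes l: "is_partition l" and u: "u \<in> linear_extensions (cells_of l)"
    and s: "s \<in> compatible (sum_list l) (descent_positions (descents cell_less u)) a"
  shows "sorted (map (std_key (fill (u, s))) u)"
proof -
  have du: "distinct u" "set u = cells_of l" using u by (auto simp: linear_extensions_def)
  have len: "length u = sum_list l" using distinct_card[OF du(1)] du(2) card_cells_of(2)[of l] by simp
  have ls: "length s = length u" "sorted s" using s len by (auto simp: compatible_def)
  have f: "fill (u, s) (u ! t) = s ! t" if "t < length u" for t
    using that index_nth[OF du(1)] by (simp add: fill_def)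
  have "std_key (fill (u, s)) (u ! t) \<le> std_key (fill (u, s)) (u ! Suc t)" if t: "Suc t < length u" for t
  proof -
    have le: "s ! t \<le> s ! Suc t" using ls t by (simp add: sorted_iff_nth_Suc)
    show ?thesis
    proof (cases "cell_less (u ! Suc t) (u ! t)")
      case True
      then have "Suc t \<in> descent_positions (descents cell_less u)" using t by (auto simp: descent_positions_descents)
      then have "s ! t < s ! Suc t" using s t len by (auto simp: compatible_def)
      then show ?thesis using t by (simp add: std_key_def f less_eq_prod_def)
    next
      case False
      then have c: "content (u ! t) \<le> content (u ! Suc t)" by (simp add: cell_less_content)
      have "fst (u ! t) \<le> fst (u ! Suc t)" if e: "content (u ! t) = content (u ! Suc t)"
      proof (rule ccontr)
        assume "\<not> ?thesis"
        then have "fst (u ! Suc t) \<le> fst (u ! t)" "snd (u ! Suc t) \<le> snd (u ! t)" "u ! Suc t \<noteq> u ! t"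
          using e by (auto simp: content_def)
        moreover have "u ! t \<in> cells_of l" using du t by (metis nth_mem Suc_lessD)
        ultimately have "index u (u ! Suc t) < index u (u ! t)"
          using linear_extension_mono[OF l u, of "fst (u ! t)" "snd (u ! t)" "fst (u ! Suc t)" "snd (u ! Suc t)"]
          by simp
        then show False using t index_nth[OF du(1)] by simp
      qed
      with le c show ?thesis using t by (fastforce simp: std_key_def f less_eq_prod_def)
    qed
  qed
  then show ?thesis by (auto simp: sorted_iff_nth_Suc)
qed

lemma fill_fillings:
  assumes l: "is_partition l" and u: "u \<in> linear_extensions (cells_of l)"
    and s: "s \<in> compatible (sum_list l) (descent_positions (descents cell_less u)) a"
  shows "fill (u, s) \<in> fillings l a"
proof -
  have du: "distinct u" "set u = cells_of l" using u by (auto simp: linear_extensions_def)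
  have len: "length u = sum_list l" using distinct_card[OF du(1)] du(2) card_cells_of(2)[of l] by simp
  have ls: "length s = length u" "sorted s" using s len by (auto simp: compatible_def)
  note inc = std_key_increasing[OF assms]
  have key: "std_key (fill (u, s)) x \<le> std_key (fill (u, s)) y"
    if "index u x < index u y" "y \<in> set u" "x \<in> set u" for x y
  proof -
    have "map (std_key (fill (u, s))) u ! index u x \<le> map (std_key (fill (u, s))) u ! index u y"
      using that index_less by (intro sorted_nth_mono[OF inc]) auto
    then show ?thesis using that index_less[of x u] index_less[of y u] nth_index[of x u] nth_index[of y u] by simp
  qed
  have "fill (u, s) (p, q) \<le> fill (u, s) (Suc p, q)" if "(p, q) \<in> cells_of l" "(Suc p, q) \<in> cells_of l" for p q
    using key[OF linear_extension_mono[OF l u that(2), of p q]] that du(2)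
    by (auto simp: std_key_def less_eq_prod_def)
  moreover have "fill (u, s) (p, q) < fill (u, s) (p, Suc q)" if "(p, q) \<in> cells_of l" "(p, Suc q) \<in> cells_of l" for p q
    using key[OF linear_extension_mono[OF l u that(2), of p q]] that du(2)
    by (auto simp: std_key_def less_eq_prod_def content_def)
  moreover have "card {x \<in> cells_of l. fill (u, s) x = v} = a v" for v
    using card_fill[OF du(1) ls(1)] s du(2) by (auto simp: compatible_def)
  ultimately show ?thesis using du(2) by (auto simp: fillings_def fill_def)
qed

text \<open>Standardisation: a semistandard filling amounts to one linear extension together with a
  sequence compatible with its descents. This is the expansion of a Schur function into fundamental
  quasisymmetric functions indexed by standard tableaux.\<close>

lemma schur_coeff_linear_extensions:
  assumes l: "is_partition l"
  shows "schur_coeff l a =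
    (\<Sum>u \<in> linear_extensions (cells_of l). Q_coeff (sum_list l) (descent_positions (descents cell_less u)) a)"
proof -
  let ?m = "sum_list l" and ?E = "linear_extensions (cells_of l)"
  let ?S = "SIGMA u:?E. compatible ?m (descent_positions (descents cell_less u)) a"
  have "inj_on fill ?S"
  proof (rule inj_onI)
    fix us vt assume A: "us \<in> ?S" "vt \<in> ?S" "fill us = fill vt"
    obtain u s v t where us: "us = (u, s)" "vt = (v, t)" by (cases us; cases vt)
    have u: "u \<in> ?E" "v \<in> ?E" "s \<in> compatible ?m (descent_positions (descents cell_less u)) a"
      "t \<in> compatible ?m (descent_positions (descents cell_less v)) a" using A us by auto
    have d: "distinct u" "set u = cells_of l" "distinct v" "set v = cells_of l"
      using u by (auto simp: linear_extensions_def)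
    \<comment> \<open>Both lists enumerate the keys of the same filling in increasing order, so the
      filling determines the linear extension.\<close>
    have "map (std_key (fill us)) u = map (std_key (fill us)) v"
      using std_key_increasing[OF l u(1,3)] std_key_increasing[OF l u(2,4)] d A(3) us
      by (intro sorted_distinct_set_unique) (auto simp: distinct_map intro: inj_on_subset[OF inj_std_key])
    then have uv: "u = v" using inj_std_key by (metis inj_map_eq_map)
    have "length u = ?m" using distinct_card[OF d(1)] d(2) card_cells_of(2)[of l] by simp
    moreover have "s ! i = t ! i" if "i < length u" for i
      using fun_cong[OF A(3), of "u ! i"] that us uv index_nth[OF d(1)] by (simp add: fill_def)
    ultimately have "s = t" using u(3,4) by (intro nth_equalityI) (auto simp: compatible_def)
    then show "us = vt" using us uv by simp
  qed
  moreover have "fill ` ?S = fillings l a"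
  proof (intro equalityI subsetI)
    fix T assume "T \<in> fill ` ?S"
    then show "T \<in> fillings l a" using fill_fillings[OF l] by auto
  next
    fix T assume T: "T \<in> fillings l a"
    define u where "u = sort_key (std_key T) (cells 0 l)"
    define s where "s = map T u"
    have u: "distinct u" "set u = cells_of l" "length u = ?m"
      using distinct_cells set_cells_0 length_cells by (auto simp: u_def)
    have inc: "sorted (map (std_key T) u)" by (simp add: u_def)
    have sless: "std_key T (u ! i) < std_key T (u ! j)" if "i < j" "j < length u" for i j
    proof -
      have "std_key T (u ! i) \<le> std_key T (u ! j)" using sorted_nth_mono[OF inc, of i j] that by simp
      moreover have "u ! i \<noteq> u ! j" using u(1) that by (simp add: nth_eq_iff_index_eq)
      ultimately show ?thesis using inj_std_key[of T] by (metis injD order_le_less)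
    qed
    \<comment> \<open>A step to the right does not lower the entry and raises the content; a step up
      raises the entry. Hence the sorted list respects covers.\<close>
    have cov: "std_key T x < std_key T y" if c: "cell_covers x y" and "x \<in> cells_of l" "y \<in> cells_of l" for x y
    proof -
      obtain p q where x: "x = (p, q)" by (cases x)
      consider "y = (Suc p, q)" | "y = (p, Suc q)" using c x by (auto simp: cell_covers_def)
      then show ?thesis
      proof cases
        case 1
        then have "T x \<le> T y" using T \<open>x \<in> cells_of l\<close> \<open>y \<in> cells_of l\<close> x by (auto simp: fillings_def)
        then show ?thesis using 1 x by (auto simp: std_key_def less_prod_def content_def)
      next
        case 2
        then have "T x < T y" using T \<open>x \<in> cells_of l\<close> \<open>y \<in> cells_of l\<close> x by (auto simp: fillings_def)
        then show ?thesis by (auto simp: std_key_def less_prod_def)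
      qed
    qed
    have "\<not> cell_covers (u ! j) (u ! i)" if "i < j" "j < length u" for i j
      using cov[of "u ! j" "u ! i"] sless[OF that] that u(2) nth_mem[of i u] nth_mem[of j u] by fastforce
    then have E: "u \<in> ?E" using u by (auto simp: linear_extensions_def sorted_wrt_iff_nth_less)
    have sorted: "sorted s"
      using sless by (fastforce simp: s_def sorted_iff_nth_mono_less std_key_def less_prod_def)
    have fl: "fill (u, s) = T"
    proof
      fix x show "fill (u, s) x = T x"
        using T u(2) index_less[of x u] nth_index[of x u]
        by (cases x) (auto simp: fill_def s_def fillings_def)
    qed
    have "s ! t < s ! Suc t" if "Suc t < length u" "cell_less (u ! Suc t) (u ! t)" for t
      using sless[of t "Suc t"] that by (auto simp: s_def std_key_def less_prod_def cell_less_content)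
    then have "\<forall>j \<in> descent_positions (descents cell_less u). 1 \<le> j \<and> j < ?m \<longrightarrow> s ! (j - 1) < s ! j"
      by (auto simp: descent_positions_descents)
    moreover have "count_list s v = a v" for v
      using card_fill[of u s v] u T fl by (auto simp: fillings_def s_def)
    ultimately have "s \<in> compatible ?m (descent_positions (descents cell_less u)) a"
      using sorted u(3) by (auto simp: compatible_def s_def)
    then show "T \<in> fill ` ?S" using E fl by force
  qed
  ultimately have "card (fillings l a) = card ?S" by (metis card_image)
  moreover have "finite ?E"
    using set_linexts[OF distinct_cells[of 0 l]] set_cells_0 by (metis List.finite_set)
  ultimately have "card (fillings l a) = (\<Sum>u \<in> ?E. card (compatible ?m (descent_positions (descents cell_less u)) a))"
    using finite_compatible by simp
  then show ?thesis by (simp add: fillings_def schur_coeff_def compatible_def Q_coeff_def)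
qed

text \<open>Different tableaux may share a descent set; the list stands for a multiset.\<close>

definition tableau_descents :: "nat list \<Rightarrow> bool list list" where
  "tableau_descents l = map (descents cell_less) (linexts (cells 0 l))"

lemma schur_coeff_tableau_descents:
  assumes "is_partition l"
  shows "schur_coeff l a = (\<Sum>d\<leftarrow>tableau_descents l. Q_coeff (sum_list l) (descent_positions d) a)"
  unfolding schur_coeff_linear_extensions[OF assms] tableau_descents_def
  using sum.distinct_set_conv_list[OF distinct_linexts[OF distinct_cells[of 0 l]]]
  by (simp add: set_cells_0 comp_def flip: set_linexts[OF distinct_cells[of 0 l], unfolded set_cells_0])

section \<open>Certified search through classes of short words\<close>

text \<open>Six constructors instead of numbers: comparisons and trie lookups are then resolved by
  pattern matching.\<close>

datatype letter = L0 | L1 | L2 | L3 | L4 | L5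

primrec idx :: "letter \<Rightarrow> nat" where
  "idx L0 = 0" | "idx L1 = 1" | "idx L2 = 2" | "idx L3 = 3" | "idx L4 = 4" | "idx L5 = 5"

instantiation letter :: linorder
begin
definition "x \<le> y \<longleftrightarrow> idx x \<le> idx y"
definition "x < y \<longleftrightarrow> idx x < idx y"
lemma idx_inj: "idx x = idx y \<Longrightarrow> x = y"
  by (cases x; cases y; simp)
instance
  by standard (auto simp: less_eq_letter_def less_letter_def intro: idx_inj)
end

lemma less_letter_code [code]:
  "L0 < L0 \<longleftrightarrow> False" "L0 < L1 \<longleftrightarrow> True" "L0 < L2 \<longleftrightarrow> True" "L0 < L3 \<longleftrightarrow> True" "L0 < L4 \<longleftrightarrow> True" "L0 < L5 \<longleftrightarrow> True"
  "L1 < L0 \<longleftrightarrow> False" "L1 < L1 \<longleftrightarrow> False" "L1 < L2 \<longleftrightarrow> True" "L1 < L3 \<longleftrightarrow> True" "L1 < L4 \<longleftrightarrow> True" "L1 < L5 \<longleftrightarrow> True"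
  "L2 < L0 \<longleftrightarrow> False" "L2 < L1 \<longleftrightarrow> False" "L2 < L2 \<longleftrightarrow> False" "L2 < L3 \<longleftrightarrow> True" "L2 < L4 \<longleftrightarrow> True" "L2 < L5 \<longleftrightarrow> True"
  "L3 < L0 \<longleftrightarrow> False" "L3 < L1 \<longleftrightarrow> False" "L3 < L2 \<longleftrightarrow> False" "L3 < L3 \<longleftrightarrow> False" "L3 < L4 \<longleftrightarrow> True" "L3 < L5 \<longleftrightarrow> True"
  "L4 < L0 \<longleftrightarrow> False" "L4 < L1 \<longleftrightarrow> False" "L4 < L2 \<longleftrightarrow> False" "L4 < L3 \<longleftrightarrow> False" "L4 < L4 \<longleftrightarrow> False" "L4 < L5 \<longleftrightarrow> True"
  "L5 < L0 \<longleftrightarrow> False" "L5 < L1 \<longleftrightarrow> False" "L5 < L2 \<longleftrightarrow> False" "L5 < L3 \<longleftrightarrow> False" "L5 < L4 \<longleftrightarrow> False" "L5 < L5 \<longleftrightarrow> False"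
  by (simp_all add: less_letter_def)

text \<open>The arguments say which pairs of letters are far apart. Only pairs with a letter in between
  matter, since a move compares the extremes of three distinct letters.\<close>
datatype farness = Far bool bool bool bool bool bool bool bool bool bool

fun far :: "farness \<Rightarrow> letter \<Rightarrow> letter \<Rightarrow> bool" where
  "far (Far a b c d e f g h i j) L0 L2 = a"
| "far (Far a b c d e f g h i j) L1 L3 = b"
| "far (Far a b c d e f g h i j) L2 L4 = c"
| "far (Far a b c d e f g h i j) L3 L5 = d"
| "far (Far a b c d e f g h i j) L0 L3 = e"
| "far (Far a b c d e f g h i j) L1 L4 = f"
| "far (Far a b c d e f g h i j) L2 L5 = g"
| "far (Far a b c d e f g h i j) L0 L4 = h"
| "far (Far a b c d e f g h i j) L1 L5 = i"
| "far (Far a b c d e f g h i j) L0 L5 = j"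
| "far _ _ _ = False"

definition pick :: "bool \<Rightarrow> 'a \<Rightarrow> 'a \<Rightarrow> 'a" where
  "pick b x y = (if b then x else y)"

lemma pick_code [code, simp]: "pick True x y = x" "pick False x y = y"
  by (auto simp: pick_def)

text \<open>The booleans are the truth values of \<open>a < b\<close>, \<open>b < c\<close> and
  \<open>a < c\<close>. \<open>None\<close> stands for a triple whose middle letter is also middle
  in size, which \<open>move3\<close> fixes.\<close>

fun move :: "farness \<Rightarrow> letter \<Rightarrow> letter \<Rightarrow> letter \<Rightarrow> bool \<Rightarrow> bool \<Rightarrow> bool \<Rightarrow> letter list option" where
  "move F a b c True True _ = None"
| "move F a b c False False _ = None"
| "move F a b c True False True = Some (pick (far F a b) [b,a,c] [c,a,b])"
| "move F a b c True False False = Some (pick (far F c b) [a,c,b] [b,c,a])"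
| "move F a b c False True True = Some (pick (far F b c) [a,c,b] [b,c,a])"
| "move F a b c False True False = Some (pick (far F b a) [b,a,c] [c,a,b])"

fun nbrs_aux :: "letter \<Rightarrow> letter list list \<Rightarrow> letter list option \<Rightarrow> letter list \<Rightarrow> letter list list" where
  "nbrs_aux a vs None u = map ((#) a) vs"
| "nbrs_aux a vs (Some t) u = (t @ u) # map ((#) a) vs"

fun nbrs :: "farness \<Rightarrow> letter list \<Rightarrow> letter list list" where
  "nbrs F (a # b # c # u) = nbrs_aux a (nbrs F (b # c # u)) (move F a b c (a < b) (b < c) (a < c)) u"
| "nbrs F _ = []"

section \<open>Sets of words as tries, and the search for a class\<close>

datatype trie = Emp | Leaf | Node trie trie trie trie trie trie

fun mem :: "trie \<Rightarrow> letter list \<Rightarrow> bool" where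
  "mem Emp w = False"
| "mem Leaf w = (w = [])"
| "mem (Node a b c d e f) [] = False"
| "mem (Node a b c d e f) (L0 # w) = mem a w"
| "mem (Node a b c d e f) (L1 # w) = mem b w"
| "mem (Node a b c d e f) (L2 # w) = mem c w"
| "mem (Node a b c d e f) (L3 # w) = mem d w"
| "mem (Node a b c d e f) (L4 # w) = mem e w"
| "mem (Node a b c d e f) (L5 # w) = mem f w"

fun path :: "letter list \<Rightarrow> trie" where
  "path [] = Leaf"
| "path (L0 # w) = Node (path w) Emp Emp Emp Emp Emp"
| "path (L1 # w) = Node Emp (path w) Emp Emp Emp Emp"
| "path (L2 # w) = Node Emp Emp (path w) Emp Emp Emp"
| "path (L3 # w) = Node Emp Emp Emp (path w) Emp Emp"
| "path (L4 # w) = Node Emp Emp Emp Emp (path w) Emp"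
| "path (L5 # w) = Node Emp Emp Emp Emp Emp (path w)"

text \<open>All words of a trie have the same length, so no clause discards information.\<close>
fun ins :: "letter list \<Rightarrow> trie \<Rightarrow> trie" where
  "ins w Emp = path w"
| "ins w Leaf = Leaf"
| "ins [] (Node a b c d e f) = Node a b c d e f"
| "ins (L0 # w) (Node a b c d e f) = Node (ins w a) b c d e f"
| "ins (L1 # w) (Node a b c d e f) = Node a (ins w b) c d e f"
| "ins (L2 # w) (Node a b c d e f) = Node a b (ins w c) d e f"
| "ins (L3 # w) (Node a b c d e f) = Node a b c (ins w d) e f"
| "ins (L4 # w) (Node a b c d e f) = Node a b c d (ins w e) f"
| "ins (L5 # w) (Node a b c d e f) = Node a b c d e (ins w f)"

text \<open>The arguments are a stack, the words seen so far and the words collected in this search.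
  Termination is not proved: the facts below start from a result \<open>Some\<close>, which
  evaluation provides.\<close>

partial_function (option) dfs ::
  "farness \<Rightarrow> letter list list \<Rightarrow> trie \<Rightarrow> letter list list \<Rightarrow> (trie \<times> letter list list) option" where
  "dfs F st vis acc = (case st of [] \<Rightarrow> Some (vis, acc)
     | u # s \<Rightarrow> if mem vis u then dfs F s vis acc
               else dfs F (nbrs F u @ s) (ins u vis) (u # acc))"

text \<open>Splitting recursive functions into mutually recursive pattern equations keeps large
  arguments out of \<open>if\<close> and \<open>case\<close>: under the congruence rules for these, \<open>code_simp\<close> would
  traverse the arguments again at every step.\<close>
definition dfs_step where
  "dfs_step b F u s vis acc = (if b then dfs F s vis acc
     else dfs F (nbrs F u @ s) (ins u vis) (u # acc))"

lemma dfs_code [code]: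
  "dfs F [] vis acc = Some (vis, acc)"
  "dfs F (u # s) vis acc = dfs_step (mem vis u) F u s vis acc"
  by (subst dfs.simps; simp add: dfs_step_def)+

lemma dfs_step_code [code]:
  "dfs_step True F u s vis acc = dfs F s vis acc"
  "dfs_step False F u s vis acc = dfs F (nbrs F u @ s) (ins u vis) (u # acc)"
  by (simp_all add: dfs_step_def)

lemma move_move3:
  assumes "distinct [a, b, c]"
  shows "move3 (far F) a b c = (case move F a b c (a < b) (b < c) (a < c) of None \<Rightarrow> [a, b, c] | Some t \<Rightarrow> t)"
proof -
  have "b < a \<longleftrightarrow> \<not> a < b" "c < b \<longleftrightarrow> \<not> b < c" "c < a \<longleftrightarrow> \<not> a < c"
    using assms by fastforce+
  then show ?thesis
    by (cases "a < b"; cases "b < c"; cases "a < c") (auto simp: move3_def pick_def)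
qed

text \<open>\<open>nbrs\<close> skips the triples that a move fixes, hence the first
  alternative.\<close>

lemma nbrs_act:
  "distinct u \<Longrightarrow> j + 2 < length u \<Longrightarrow> act (far F) j u = u \<or> act (far F) j u \<in> set (nbrs F u)"
proof (induction F u arbitrary: j rule: nbrs.induct)
  case (1 F a b c u)
  show ?case
  proof (cases j)
    case 0
    then show ?thesis using 1(2) move_move3[of a b c F]
      by (cases "move F a b c (a < b) (b < c) (a < c)") (auto simp: act_0)
  next
    case (Suc i)
    with 1 have "act (far F) i (b # c # u) = b # c # u \<or> act (far F) i (b # c # u) \<in> set (nbrs F (b # c # u))"
      by (intro 1(1)) auto
    then show ?thesis using Suc
      by (cases "move F a b c (a < b) (b < c) (a < c)") (auto simp: act_Cons)
  qed
qed auto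

lemma act_nbrs:
  "distinct u \<Longrightarrow> v \<in> set (nbrs F u) \<Longrightarrow> \<exists>j. j + 2 < length u \<and> v = act (far F) j u"
proof (induction F u arbitrary: v rule: nbrs.induct)
  case (1 F a b c u)
  have "(\<exists>t. v = t @ u \<and> move F a b c (a < b) (b < c) (a < c) = Some t)
     \<or> (\<exists>w \<in> set (nbrs F (b # c # u)). v = a # w)"
    using 1(3) by (cases "move F a b c (a < b) (b < c) (a < c)") auto
  then show ?case
  proof (elim disjE bexE exE conjE)
    fix t assume "v = t @ u" "move F a b c (a < b) (b < c) (a < c) = Some t"
    then show ?thesis using move_move3[of a b c F] 1(2) by (intro exI[of _ 0]) (auto simp: act_0)
  next
    fix w assume w: "w \<in> set (nbrs F (b # c # u))" "v = a # w"
    then obtain j where "j + 2 < length (b # c # u)" "w = act (far F) j (b # c # u)"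
      using 1(1)[of w] 1(2) by auto
    then show ?thesis using w by (intro exI[of _ "Suc j"]) (auto simp: act_Cons)
  qed
qed auto

fun uniform :: "nat \<Rightarrow> trie \<Rightarrow> bool" where
  "uniform m Emp = True"
| "uniform m Leaf = (m = 0)"
| "uniform 0 (Node a b c d e f) = False"
| "uniform (Suc m) (Node a b c d e f) = (uniform m a \<and> uniform m b \<and> uniform m c \<and>
     uniform m d \<and> uniform m e \<and> uniform m f)"

lemma path_spec: "uniform (length w) (path w) \<and> (\<forall>v. mem (path w) v \<longleftrightarrow> v = w)"
proof (induction w)
  case (Cons l w)
  have "mem (path (l # w)) v \<longleftrightarrow> v = l # w" for v
    using Cons.IH by (cases l; cases v; cases "hd v") auto
  then show ?case using Cons.IH by (cases l) auto
qed simp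

lemma ins_spec:
  "length w = m \<Longrightarrow> uniform m t \<Longrightarrow> uniform m (ins w t) \<and> (\<forall>v. mem (ins w t) v \<longleftrightarrow> v = w \<or> mem t v)"
proof (induction w arbitrary: m t)
  case Nil
  then show ?case by (cases t) auto
next
  case (Cons l w)
  then obtain m' where m: "m = Suc m'" "length w = m'" by auto
  show ?case
  proof (cases t)
    case Emp
    then show ?thesis using path_spec[of "l # w"] Cons.prems by auto
  next
    case Leaf
    then show ?thesis using Cons.prems by auto
  next
    case (Node a b c d e f)
    then have IH: "uniform m' (ins w s) \<and> (\<forall>v. mem (ins w s) v \<longleftrightarrow> v = w \<or> mem s v)"
      if "s \<in> {a, b, c, d, e, f}" for s
      using Cons m that by auto
    have "mem (ins (l # w) t) v \<longleftrightarrow> v = l # w \<or> mem t v" for v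
      unfolding Node using IH by (cases l; cases v; cases "hd v") auto
    moreover have "uniform m (ins (l # w) t)"
      using IH Cons.prems unfolding Node m(1) by (cases l) auto
    ultimately show ?thesis by blast
  qed
qed

text \<open>\<open>new\<close> is what the call adds. Closure under neighbours is claimed for
  \<open>new\<close> only, because a word already in \<open>vis\<close> may have neighbours waiting
  on the stack. For the word just popped it follows from the clause that every stacked word ends up
  visited.\<close>

lemma dfs_spec:
  "dfs F st vis acc = Some y \<Longrightarrow> uniform m vis \<Longrightarrow> \<forall>u \<in> set st. distinct u \<and> length u = m \<Longrightarrow>
    \<exists>new. snd y = new @ acc \<and> distinct new \<and> uniform m (fst y) \<and>
    (\<forall>v. mem (fst y) v \<longleftrightarrow> mem vis v \<or> v \<in> set new) \<and> (\<forall>v \<in> set new. \<not> mem vis v) \<and>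
    (\<forall>v \<in> set new. \<exists>u \<in> set st. v \<in> reach (far F) u) \<and>
    (\<forall>u \<in> set st. mem (fst y) u) \<and> (\<forall>v \<in> set new. \<forall>w \<in> set (nbrs F v). mem (fst y) w)"
proof (induction F st vis acc y rule: dfs.raw_induct[rotated, consumes 1, case_names call])
  case (call rec F st vis acc y)
  show ?case
  proof (cases st)
    case Nil
    with call show ?thesis by (intro exI[of _ "[]"]) auto
  next
    case (Cons u s)
    show ?thesis
    proof (cases "mem vis u")
      case True
      then have "rec F s vis acc = Some y" using call.prems(1) call.hyps Cons by simp
      from call.IH[OF this call.prems(1)] call.prems(2) Cons obtain new where
        "snd y = new @ acc" "distinct new" "uniform m (fst y)"
        "\<forall>v. mem (fst y) v \<longleftrightarrow> mem vis v \<or> v \<in> set new" "\<forall>v \<in> set new. \<not> mem vis v"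
        "\<forall>v \<in> set new. \<exists>u \<in> set s. v \<in> reach (far F) u"
        "\<forall>u \<in> set s. mem (fst y) u" "\<forall>v \<in> set new. \<forall>w \<in> set (nbrs F v). mem (fst y) w"
        by auto
      then show ?thesis using Cons True by (intro exI[of _ new]) auto
    next
      case False
      have du: "distinct u" "length u = m" using call.prems(2) Cons by auto
      have nb: "distinct w \<and> length w = m \<and> w \<in> reach (far F) u" if w: "w \<in> set (nbrs F u)" for w
      proof -
        obtain j where j: "j + 2 < length u" "w = act (far F) j u" using act_nbrs[OF du(1) w] by auto
        then show ?thesis using du distinct_act[OF j(1) du(1)] reach_step[OF reach_refl j(1)] by simp
      qed
      have vis': "uniform m (ins u vis)" "\<And>v. mem (ins u vis) v \<longleftrightarrow> v = u \<or> mem vis v"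
        using ins_spec[OF du(2) call.prems(1)] by auto
      have "rec F (nbrs F u @ s) (ins u vis) (u # acc) = Some y" using False call.hyps Cons by simp
      moreover have "\<forall>u \<in> set (nbrs F u @ s). distinct u \<and> length u = m"
        using nb call.prems(2) Cons by auto
      ultimately obtain new where new: "snd y = new @ u # acc" "distinct new" "uniform m (fst y)"
        "\<forall>v. mem (fst y) v \<longleftrightarrow> mem (ins u vis) v \<or> v \<in> set new"
        "\<forall>v \<in> set new. \<not> mem (ins u vis) v"
        "\<forall>v \<in> set new. \<exists>u \<in> set (nbrs F u @ s). v \<in> reach (far F) u"
        "\<forall>u \<in> set (nbrs F u @ s). mem (fst y) u"
        "\<forall>v \<in> set new. \<forall>w \<in> set (nbrs F v). mem (fst y) w"
        using call.IH[OF _ vis'(1)] by blast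
      have "\<exists>u' \<in> set st. v \<in> reach (far F) u'" if "v \<in> set (new @ [u])" for v
      proof (cases "v = u")
        case True then show ?thesis using Cons reach_refl by auto
      next
        case False
        then have "v \<in> set new" using that by simp
        then obtain u' where u': "u' \<in> set (nbrs F u @ s)" "v \<in> reach (far F) u'"
          using new(6) by blast
        then show ?thesis using nb[of u'] reach_trans Cons by auto
      qed
      then show ?thesis using new vis' False Cons by (intro exI[of _ "new @ [u]"]) auto
    qed
  qed
qed

text \<open>A search may be cut short by words of \<open>vis\<close>. As moves are reversible and
  \<open>vis\<close> is closed under \<open>reach\<close>, a neighbour in \<open>vis\<close> would
  put the new word itself into \<open>vis\<close>; so the whole class of \<open>u\<close> is
  found.\<close>

lemma dfs_class:
  assumes "dfs F [u] vis [] = Some (vis', C)" "uniform m vis" "distinct u" "length u = m"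
    and "\<not> mem vis u"
    and closed: "\<And>v w. mem vis v \<Longrightarrow> w \<in> reach (far F) v \<Longrightarrow> mem vis w"
  shows "set C = reach (far F) u" "distinct C" "uniform m vis'"
    "\<And>v. mem vis' v \<longleftrightarrow> mem vis v \<or> v \<in> set C"
proof -
  obtain new where "C = new @ []" and new: "distinct new" "uniform m vis'"
      "\<forall>v. mem vis' v \<longleftrightarrow> mem vis v \<or> v \<in> set new" "\<forall>v \<in> set new. \<not> mem vis v"
      "\<forall>v \<in> set new. v \<in> reach (far F) u" "mem vis' u"
      "\<forall>v \<in> set new. \<forall>w \<in> set (nbrs F v). mem vis' w"
    using dfs_spec[OF assms(1,2)] assms(3,4) by auto
  then have C: "C = new" by simp
  show "distinct C" "uniform m vis'" "\<And>v. mem vis' v \<longleftrightarrow> mem vis v \<or> v \<in> set C"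
    using new C by auto
  have "v \<in> set new" if "v \<in> reach (far F) u" for v
    using that
  proof (induction rule: reach_induct)
    case refl then show ?case using new assms(5) by auto
  next
    case (step v j)
    have d: "distinct v" using reach_perm[OF step.hyps(1) assms(3)] by simp
    let ?w = "act (far F) j v"
    have "v \<in> reach (far F) ?w"
      using reach_sym[OF reach_step[OF reach_refl step.hyps(2)] d] .
    then have "\<not> mem vis ?w" using closed[of ?w v] new(4) step.IH by blast
    then show ?case using nbrs_act[OF d step.hyps(2), of F] new step.IH by auto
  qed
  then show "set C = reach (far F) u" using new C by auto
qed

section \<open>Splitting multisets of descent sets into Schur parts\<close>

fun remove_all :: "'a list \<Rightarrow> 'a list \<Rightarrow> 'a list option"
  and remove_all_aux :: "bool \<Rightarrow> 'a \<Rightarrow> 'a list \<Rightarrow> 'a list \<Rightarrow> 'a list option" where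
  "remove_all [] D = Some D"
| "remove_all (t # ts) D = remove_all_aux (t \<in> set D) t ts D"
| "remove_all_aux True t ts D = remove_all ts (remove1 t D)"
| "remove_all_aux False t ts D = None"

fun opt_cons :: "'a \<Rightarrow> 'a list option \<Rightarrow> 'a list option" where
  "opt_cons a None = None"
| "opt_cons a (Some l) = Some (a # l)"

text \<open>A greedy subtraction: the current shape stays in the list after a success, since a Schur
  function may occur several times, and a shape that does not fit is dropped for good.\<close>

partial_function (option) peel ::
  "('l \<times> bool list list) list \<Rightarrow> bool list list \<Rightarrow> 'l list option" where
  "peel ts D = (case ts of [] \<Rightarrow> if D = [] then Some [] else None
     | t # ts' \<Rightarrow> (case remove_all (snd t) D of
         None \<Rightarrow> peel ts' D
       | Some D' \<Rightarrow> Option.bind (peel ts D') (\<lambda>ls. Some (fst t # ls))))"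

definition "peel_aux l t ts D r = (case r of None \<Rightarrow> peel ts D | Some D' \<Rightarrow> opt_cons l (peel ((l,t) # ts) D'))"

lemma opt_cons_bind: "opt_cons a x = Option.bind x (\<lambda>l. Some (a # l))"
  by (cases x) auto

lemma peel_code [code]:
  "peel [] [] = Some []"
  "peel [] (d # D) = None"
  "peel ((l, t) # ts) D = peel_aux l t ts D (remove_all t D)"
  by (subst peel.simps; simp add: peel_aux_def opt_cons_bind split: option.split)+

lemma peel_aux_code [code]:
  "peel_aux l t ts D None = peel ts D"
  "peel_aux l t ts D (Some D') = opt_cons l (peel ((l,t) # ts) D')"
  by (auto simp: peel_aux_def)

lemma remove_all_sum:
  fixes g :: "'a \<Rightarrow> nat"
  shows "remove_all t D = Some D' \<Longrightarrow> sum_list (map g D) = sum_list (map g t) + sum_list (map g D')"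
    "remove_all_aux b a t D = Some D' \<Longrightarrow> b = (a \<in> set D) \<Longrightarrow>
       sum_list (map g D) = sum_list (map g (a # t)) + sum_list (map g D')"
proof (induction t D and b a t D arbitrary: D' and D' rule: remove_all_remove_all_aux.induct)
  case (3 t ts D)
  then show ?case using sum_list_map_remove1[of t D g] by simp
qed auto

text \<open>Soundness of the greedy search: a successful run gives the identity for every weight
  \<open>g\<close>, later taken to be a coefficient of the quasisymmetric function of a descent
  set.\<close>

lemma peel_sum:
  fixes g :: "bool list \<Rightarrow> nat"
  shows "peel ts D = Some ls \<Longrightarrow> \<forall>(l, t) \<in> set ts. t = f l \<Longrightarrow>
    set ls \<subseteq> fst ` set ts \<and> sum_list (map g D) = (\<Sum>l\<leftarrow>ls. sum_list (map g (f l)))"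
proof (induction ts D ls rule: peel.raw_induct[rotated, consumes 1, case_names call])
  case (call rec ts D ls)
  show ?case
  proof (cases ts)
    case Nil
    then show ?thesis using call by (auto split: if_splits)
  next
    case (Cons t ts')
    show ?thesis
    proof (cases "remove_all (snd t) D")
      case None
      then have "rec ts' D = Some ls" using call.hyps Cons by simp
      from call.IH[OF this] call.prems Cons show ?thesis by auto
    next
      case (Some D')
      then obtain ls' where ls': "rec ts D' = Some ls'" "ls = fst t # ls'"
        using call.hyps Cons by (auto simp: bind_eq_Some_conv)
      from call.IH[OF this(1) call.prems] remove_all_sum(1)[OF Some, of g] call.prems Cons ls'
      show ?thesis by auto
    qed
  qed
qed

definition gap :: "'a list \<Rightarrow> 'a \<Rightarrow> 'a \<Rightarrow> bool" where
  "gap v s t \<longleftrightarrow> index v s + 3 \<le> index v t"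

text \<open>The words that come from tableaux are spread with respect to the windows of four consecutive
  letters if \<open>k \<le> 2\<close>.\<close>
definition spread :: "('a \<Rightarrow> 'a \<Rightarrow> bool) \<Rightarrow> ('a \<times> 'a \<times> 'a \<times> 'a) list \<Rightarrow> 'a list \<Rightarrow> bool" where
  "spread F qs v \<longleftrightarrow> (\<forall>(p, q, r, s) \<in> set qs. F p s \<or> gap v p q \<or> gap v q r \<or> gap v r s)"

lemma spread_code [code]:
  "spread F [] v = True"
  "spread F (x # qs) v = (case x of (p, q, r, s) \<Rightarrow>
     (F p s \<or> gap v p q \<or> gap v q r \<or> gap v r s) \<and> spread F qs v)"
  by (auto simp: spread_def)

fun some_unspread where
  "some_unspread F qs [] = False"
| "some_unspread F qs (v # vs) = (\<not> spread (far F) qs v \<or> some_unspread F qs vs)"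

text \<open>An expansion with several parts has to be excused by an unspread word, since none occurs
  in the classes coming from tableaux with \<open>k \<le> 2\<close>.\<close>

fun good_parts where
  "good_parts qs F C None = False"
| "good_parts qs F C (Some []) = False"
| "good_parts qs F C (Some [l]) = True"
| "good_parts qs F C (Some (l # l' # ls)) = some_unspread F qs C"

fun good_classes where
  "good_classes S qs F vis [] = True"
| "good_classes S qs F vis (u # us) = (if mem vis u then good_classes S qs F vis us
     else case dfs F [u] vis [] of None \<Rightarrow> False
        | Some (vis', C) \<Rightarrow> good_parts qs F C (peel S (map word_descents C)) \<and> good_classes S qs F vis' us)"

definition "classes_member S qs F vis u us b = (if b then good_classes S qs F vis us
   else case dfs F [u] vis [] of None \<Rightarrow> False
        | Some (vis', C) \<Rightarrow> good_parts qs F C (peel S (map word_descents C)) \<and> good_classes S qs F vis' us)"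

definition "classes_search S qs F us r = (case r of None \<Rightarrow> False
        | Some (vis', C) \<Rightarrow> good_parts qs F C (peel S (map word_descents C)) \<and> good_classes S qs F vis' us)"

definition "classes_verdict S qs F us vis b = (b \<and> good_classes S qs F vis us)"

lemma good_classes_code [code]:
  "good_classes S qs F vis [] = True"
  "good_classes S qs F vis (u # us) = classes_member S qs F vis u us (mem vis u)"
  by (auto simp: classes_member_def)

lemma classes_member_code [code]:
  "classes_member S qs F vis u us True = good_classes S qs F vis us"
  "classes_member S qs F vis u us False = classes_search S qs F us (dfs F [u] vis [])"
  by (auto simp: classes_member_def classes_search_def)

lemma classes_search_code [code]:
  "classes_search S qs F us None = False"
  "classes_search S qs F us (Some (vis', C)) =
     classes_verdict S qs F us vis' (good_parts qs F C (peel S (map word_descents C)))"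
  by (auto simp: classes_verdict_def classes_search_def)

lemma classes_verdict_code [code]:
  "classes_verdict S qs F us vis True = good_classes S qs F vis us"
  "classes_verdict S qs F us vis False = False"
  by (auto simp: classes_verdict_def)

fun perms :: "nat \<Rightarrow> 'a list \<Rightarrow> 'a list list" where
  "perms 0 xs = [[]]"
| "perms (Suc m) xs = concat (map (\<lambda>x. map ((#) x) (perms m (remove1 x xs))) xs)"

lemma in_perms: "distinct v \<Longrightarrow> set v \<subseteq> set xs \<Longrightarrow> distinct xs \<Longrightarrow> v \<in> set (perms (length v) xs)"
proof (induction v arbitrary: xs)
  case (Cons a v)
  then have "v \<in> set (perms (length v) (remove1 a xs))" by (intro Cons.IH) auto
  then show ?case using Cons.prems by auto
qed simp

lemma perms_length: "distinct xs \<Longrightarrow> v \<in> set (perms m xs) \<Longrightarrow> length v = m \<and> distinct v \<and> set v \<subseteq> set xs"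
proof (induction m arbitrary: xs v)
  case (Suc m)
  then obtain x w where "x \<in> set xs" "v = x # w" "w \<in> set (perms m (remove1 x xs))" by auto
  with Suc.IH[of "remove1 x xs" w] Suc.prems(1) show ?case by auto
qed simp

lemma good_parts_spec:
  "good_parts qs F C r \<Longrightarrow> \<exists>ls. r = Some ls \<and> (length ls = 1 \<or> (\<exists>v \<in> set C. \<not> spread (far F) qs v))"
proof (induction qs F C r rule: good_parts.induct)
  case (4 qs F C l l' ls)
  have "some_unspread F qs C \<Longrightarrow> \<exists>v \<in> set C. \<not> spread (far F) qs v" by (induction C) auto
  with 4 show ?case by auto
qed auto

text \<open>The invariant is that \<open>vis\<close> is a union of complete classes, each already
  certified. A word found in \<open>vis\<close> is thus settled, and by \<open>dfs_class\<close> a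
  search from any other word preserves the invariant.\<close>

lemma good_classes_spec:
  assumes "good_classes S qs F vis us" "uniform m vis" "\<forall>u \<in> set us. distinct u \<and> length u = m"
    and "\<And>v. mem vis v \<Longrightarrow> reach (far F) v \<subseteq> {w. mem vis w}"
    and "\<And>v. mem vis v \<Longrightarrow> \<exists>C. distinct C \<and> set C = reach (far F) v \<and> good_parts qs F C (peel S (map word_descents C))"
    and "u \<in> set us"
  shows "\<exists>C. distinct C \<and> set C = reach (far F) u \<and> good_parts qs F C (peel S (map word_descents C))"
  using assms
proof (induction us arbitrary: vis)
  case (Cons x us)
  show ?case
  proof (cases "mem vis x")
    case True
    then show ?thesis using Cons.prems Cons.IH[of vis] by auto
  next
    case False
    obtain vis' C where d: "dfs F [x] vis [] = Some (vis', C)" and g: "good_parts qs F C (peel S (map word_descents C))"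
        and r: "good_classes S qs F vis' us"
      using Cons.prems(1) False by (auto split: option.splits)
    have x: "distinct x" "length x = m" using Cons.prems(3) by auto
    have closed: "mem vis v \<Longrightarrow> w \<in> reach (far F) v \<Longrightarrow> mem vis w" for v w
      using Cons.prems(4) by auto
    have c: "set C = reach (far F) x" "distinct C" "uniform m vis'"
        "\<And>v. mem vis' v \<longleftrightarrow> mem vis v \<or> v \<in> set C"
      using dfs_class[OF d Cons.prems(2) x False] closed by blast+
    have eq: "reach (far F) v = set C" if "v \<in> set C" for v
      using reach_eq[OF _ x(1)] c(1) that by simp
    show ?thesis
    proof (cases "u = x")
      case True then show ?thesis using c g by auto
    next
      case False
      show ?thesis
      proof (rule Cons.IH[OF r c(3)])
        show "\<forall>u \<in> set us. distinct u \<and> length u = m" "u \<in> set us" using Cons.prems False by auto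
        show "reach (far F) v \<subseteq> {w. mem vis' w}" if "mem vis' v" for v
          using that c(4) Cons.prems(4) eq by blast
        show "\<exists>C. distinct C \<and> set C = reach (far F) v \<and> good_parts qs F C (peel S (map word_descents C))"
          if "mem vis' v" for v
          using that c(4) Cons.prems(5) eq g c(2) by blast
      qed
    qed
  qed
qed simp

text \<open>Enlarging an interval of letters keeps its ends far apart; the implications are the
  covering relations among the ten intervals. This poset is the root poset of type A_4, whose 42
  upper sets are counted by a Catalan number.\<close>

fun monotone_far :: "farness \<Rightarrow> bool" where
  "monotone_far (Far a b c d e f g h i j) \<longleftrightarrow> (a \<longrightarrow> e) \<and> (b \<longrightarrow> e \<and> f) \<and> (c \<longrightarrow> f \<and> g) \<and> (d \<longrightarrow> g) \<and>
     (e \<longrightarrow> h) \<and> (f \<longrightarrow> h \<and> i) \<and> (g \<longrightarrow> i) \<and> (h \<longrightarrow> j) \<and> (i \<longrightarrow> j)"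

fun extend_bools :: "nat \<Rightarrow> bool list list" where
  "extend_bools 0 = [[]]"
| "extend_bools (Suc n) = map ((#) True) (extend_bools n) @ map ((#) False) (extend_bools n)"

text \<open>The first two booleans are kept apart so that the enumeration splits into four
  evaluations. The last equation is a default; \<open>extend_bools 8\<close> yields lists of length
  eight.\<close>

fun far_of :: "bool \<Rightarrow> bool \<Rightarrow> bool list \<Rightarrow> farness" where
  "far_of a b [c, d, e, f, g, h, i, j] = Far a b c d e f g h i j"
| "far_of a b _ = Far a b False False False False False False False False"

definition farnesses :: "bool \<Rightarrow> bool \<Rightarrow> farness list" where
  "farnesses a b = filter monotone_far (map (far_of a b) (extend_bools 8))"

definition letters :: "letter list" where
  "letters = [L0, L1, L2, L3, L4, L5]"

text \<open>The windows inside the first \<open>m\<close> letters are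
  \<open>take (m - 3) windows\<close>.\<close>

definition windows :: "(letter \<times> letter \<times> letter \<times> letter) list" where
  "windows = [(L0, L1, L2, L3), (L1, L2, L3, L4), (L2, L3, L4, L5)]"

text \<open>Decreasing lexicographic order makes the greedy search of \<open>peel\<close> succeed: a first tableau of
  shape \<open>l\<close>, with the entries filled in row by row, has a descent set that no lexicographically
  smaller shape attains.\<close>
definition shapes :: "nat \<Rightarrow> nat list list" where
  "shapes m =
    (if m = 3 then [[3], [2,1], [1,1,1]]
     else if m = 4 then [[4], [3,1], [2,2], [2,1,1], [1,1,1,1]]
     else if m = 5 then [[5], [4,1], [3,2], [3,1,1], [2,2,1], [2,1,1,1], [1,1,1,1,1]]
     else if m = 6 then [[6], [5,1], [4,2], [4,1,1], [3,3], [3,2,1], [3,1,1,1], [2,2,2],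
       [2,2,1,1], [2,1,1,1,1], [1,1,1,1,1,1]]
     else [])"

fun check_all where
  "check_all ts qs us [] = True"
| "check_all ts qs us (F # Fs) = (good_classes ts qs F Emp us \<and> check_all ts qs us Fs)"

definition check :: "nat \<Rightarrow> farness list \<Rightarrow> bool" where
  "check m Fs = check_all (map (\<lambda>l. (l, tableau_descents l)) (shapes m)) (take (m - 3) windows)
     (perms m (take m letters)) Fs"

section \<open>Evaluation for words of length 3 to 6\<close>

lemma check_3: "check 3 (farnesses a b)"
  by (cases a; cases b; simp only:; code_simp)

lemma check_4: "check 4 (farnesses a b)"
  by (cases a; cases b; simp only:; code_simp)

lemma check_5_TT: "check 5 (farnesses True True)"
  by code_simp

lemma check_5_TF: "check 5 (farnesses True False)"
  by code_simp

lemma check_5_FT: "check 5 (farnesses False True)"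
  by code_simp

lemma check_5_FF: "check 5 (farnesses False False)"
  by code_simp

lemma check_6_TT: "check 6 (farnesses True True)"
  by code_simp

lemma check_6_TF: "check 6 (farnesses True False)"
  by code_simp

lemma check_6_FT: "check 6 (farnesses False True)"
  by code_simp

lemma check_6_FF: "check 6 (farnesses False False)"
  by code_simp

lemma check_all_iff: "check_all ts qs us Fs \<longleftrightarrow> (\<forall>F \<in> set Fs. good_classes ts qs F Emp us)"
  by (induction Fs) auto

lemma monotone_farnesses: "monotone_far F \<Longrightarrow> \<exists>a b. F \<in> set (farnesses a b)"
proof (cases F)
  case (Far a b c d e f g h i j)
  have ext: "length bs = n \<Longrightarrow> bs \<in> set (extend_bools n)" for bs n
  proof (induction n arbitrary: bs)
    case (Suc n)
    from Suc.prems obtain x xs where "bs = x # xs" "length xs = n" by (cases bs) auto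
    then show ?case using Suc.IH[of xs] by (cases x) auto
  qed simp
  assume "monotone_far F"
  then have "F \<in> set (farnesses a b)"
    using Far ext[of "[c, d, e, f, g, h, i, j]" 8]
    by (auto simp: farnesses_def intro!: image_eqI[where x = "[c, d, e, f, g, h, i, j]"])
  then show ?thesis by blast
qed

lemma good_classes_monotone:
  assumes "monotone_far F" "m \<in> {3, 4, 5, 6}"
  shows "good_classes (map (\<lambda>l. (l, tableau_descents l)) (shapes m)) (take (m - 3) windows) F Emp
     (perms m (take m letters))"
proof -
  obtain a b where F: "F \<in> set (farnesses a b)" using monotone_farnesses[OF assms(1)] by auto
  have "check m (farnesses a b)"
    using assms(2) check_3[of a b] check_4[of a b] check_5_TT check_5_TF check_5_FT check_5_FF
      check_6_TT check_6_TF check_6_FT check_6_FF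
    by (cases a; cases b) auto
  then show ?thesis using F by (simp add: check_def check_all_iff)
qed

lemma shapes_partitions: "l \<in> set (shapes m) \<Longrightarrow> l \<in> partitions_of m"
  by (auto simp: shapes_def partitions_of_def is_partition_def split: if_splits)

text \<open>Every arrangement of the first \<open>m\<close> letters occurs in \<open>perms\<close>,
  so its class has been certified; \<open>peel_sum\<close> turns the splitting of descent sets into
  an equality of coefficients.\<close>

theorem class_expansion:
  fixes F :: farness
  assumes "monotone_far F" "m \<in> {3, 4, 5, 6}" "distinct v" "length v = m" "set v \<subseteq> set (take m letters)"
  shows "\<exists>ls. set ls \<subseteq> partitions_of m \<and>
    (\<forall>a. (\<Sum>w \<in> reach (far F) v. Q_coeff m (descent_positions (word_descents w)) a) = (\<Sum>l\<leftarrow>ls. schur_coeff l a)) \<and>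
    (length ls = 1 \<or> (\<exists>w \<in> reach (far F) v. \<not> spread (far F) (take (m - 3) windows) w))"
proof -
  let ?ts = "map (\<lambda>l. (l, tableau_descents l)) (shapes m)" and ?qs = "take (m - 3) windows"
  have dl: "distinct (take m letters)" by (rule distinct_take) (simp add: letters_def)
  have "v \<in> set (perms m (take m letters))" using in_perms[of v "take m letters"] assms dl by simp
  moreover have "\<forall>u \<in> set (perms m (take m letters)). distinct u \<and> length u = m"
    using perms_length[OF dl] by blast
  ultimately obtain C where C: "distinct C" "set C = reach (far F) v" "good_parts ?qs F C (peel ?ts (map word_descents C))"
    using good_classes_spec[OF good_classes_monotone[OF assms(1,2)], of m v] by auto
  then obtain ls where ls: "peel ?ts (map word_descents C) = Some ls"
      "length ls = 1 \<or> (\<exists>v \<in> set C. \<not> spread (far F) ?qs v)"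
    using good_parts_spec by blast
  have p: "set ls \<subseteq> fst ` set ?ts \<and> sum_list (map g (map word_descents C)) = (\<Sum>l\<leftarrow>ls. sum_list (map g (tableau_descents l)))"
    for g :: "bool list \<Rightarrow> nat"
    by (rule peel_sum[OF ls(1)]) auto
  have "set ls \<subseteq> fst ` set ?ts" using p by (rule conjunct1)
  then have "set ls \<subseteq> set (shapes m)" by (simp add: image_image)
  then have part: "l \<in> partitions_of m" if "l \<in> set ls" for l using shapes_partitions that by blast
  have "(\<Sum>w \<in> reach (far F) v. Q_coeff m (descent_positions (word_descents w)) a) = (\<Sum>l\<leftarrow>ls. schur_coeff l a)" for a
  proof -
    have "(\<Sum>w \<in> reach (far F) v. Q_coeff m (descent_positions (word_descents w)) a) = (\<Sum>w\<leftarrow>C. Q_coeff m (descent_positions (word_descents w)) a)"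
      using sum.distinct_set_conv_list[OF C(1)] C(2) by metis
    also have "\<dots> = (\<Sum>l\<leftarrow>ls. \<Sum>d\<leftarrow>tableau_descents l. Q_coeff m (descent_positions d) a)"
      using p[of "\<lambda>d. Q_coeff m (descent_positions d) a"] by (simp add: comp_def)
    also have "\<dots> = (\<Sum>l\<leftarrow>ls. schur_coeff l a)"
      using part schur_coeff_tableau_descents
      by (intro arg_cong[where f = sum_list] map_cong) (auto simp: partitions_of_def)
    finally show ?thesis .
  qed
  then show ?thesis using part ls(2) C(2) by blast
qed

section \<open>Tableaux as words of cells\<close>

lemma skew_convex:
  assumes "is_skew s" "(a, b) \<in> skew_cells s" "(a', b') \<in> skew_cells s"
    and "a \<le> x" "x \<le> a'" "b \<le> y" "y \<le> b'"
  shows "(x, y) \<in> skew_cells s"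
  using assms cells_of_down[of "fst s" a' b' x y] cells_of_down[of "snd s" x y a b]
  by (auto simp: is_skew_def skew_cells_def)

text \<open>Between consecutive cells of a diagonal the skew shape contains the full 2 by 2 square.
  Its other two cells carry distinct values strictly in between, so each diagonal step costs at
  least 3.\<close>

lemma diagonal_gap:
  fixes \<tau> :: "nat \<times> nat \<Rightarrow> nat"
  assumes s: "is_skew s"
    and right: "\<And>a b. (a, b) \<in> skew_cells s \<Longrightarrow> (Suc a, b) \<in> skew_cells s \<Longrightarrow> \<tau> (a, b) < \<tau> (Suc a, b)"
    and up: "\<And>a b. (a, b) \<in> skew_cells s \<Longrightarrow> (a, Suc b) \<in> skew_cells s \<Longrightarrow> \<tau> (a, b) < \<tau> (a, Suc b)"
    and inj: "inj_on \<tau> (skew_cells s)"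
    and ab: "(a, b) \<in> skew_cells s"
  shows "(a + d, b + d) \<in> skew_cells s \<Longrightarrow> \<tau> (a, b) + 3 * d \<le> \<tau> (a + d, b + d)"
proof (induction d)
  case (Suc d)
  let ?x = "a + d" and ?y = "b + d"
  have c: "(?x, ?y) \<in> skew_cells s" "(Suc ?x, ?y) \<in> skew_cells s" "(?x, Suc ?y) \<in> skew_cells s"
    "(Suc ?x, Suc ?y) \<in> skew_cells s"
    using skew_convex[OF s ab Suc.prems] by auto
  then have "\<tau> (?x, ?y) < \<tau> (Suc ?x, ?y)" "\<tau> (?x, ?y) < \<tau> (?x, Suc ?y)"
    "\<tau> (Suc ?x, ?y) < \<tau> (Suc ?x, Suc ?y)" "\<tau> (?x, Suc ?y) < \<tau> (Suc ?x, Suc ?y)"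
    using right up by auto
  moreover have "\<tau> (Suc ?x, ?y) \<noteq> \<tau> (?x, Suc ?y)" using inj_onD[OF inj _ c(2,3)] by auto
  ultimately show ?case using Suc.IH[OF c(1)] by simp
qed simp

lemma bij_betw_index: "distinct xs \<Longrightarrow> bij_betw (index xs) (set xs) {..<length xs}"
  by (rule bij_betw_byWitness[where f' = "(!) xs"]) (auto simp: index_less nth_index index_nth)

text \<open>\<open>f\<close> renames the entries, whose old positions are \<open>p\<close>,
  \<open>q\<close>, \<open>r\<close>. The last equation reads the new entries at the positions
  listed by \<open>move3\<close> and finds them in order: \<open>move3\<close> lists the new
  positions. For \<open>d_op\<close> the triple counts as far, for \<open>dt_op\<close> below as
  close.\<close>

lemma d_op_map:
  assumes "index w (i - 1) = p" "index w i = q" "index w (i + 1) = r" "distinct [p, q, r]" "0 < i"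
  shows "\<exists>f. d_op i w = map f w \<and> (\<forall>v. v \<notin> {i - 1, i, i + 1} \<longrightarrow> f v = v) \<and>
    map (\<lambda>x. f (if x = p then i - 1 else if x = q then i else i + 1)) (move3 (\<lambda>x y. True) p q r)
      = [i - 1, i, i + 1]"
proof -
  consider "p < q" "q < r" | "r < q" "q < p" | "p < q" "r < q" "p < r" | "p < q" "r < q" "r < p"
    | "q < p" "q < r" "p < r" | "q < p" "q < r" "r < p"
    using assms(4) by fastforce
  then show ?thesis
  proof cases
    case 1 then show ?thesis using assms
      by (intro exI[of _ id]) (auto simp: d_op_def between_def move3_def)
  next
    case 2 then show ?thesis using assms
      by (intro exI[of _ id]) (auto simp: d_op_def between_def move3_def)
  next
    case 3 then show ?thesis using assms
      by (intro exI[of _ "\<lambda>v. if v = i then i - 1 else if v = i - 1 then i else v"])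
        (auto simp: d_op_def between_def move3_def swap_vals_def Let_def)
  next
    case 4 then show ?thesis using assms
      by (intro exI[of _ "\<lambda>v. if v = i then i + 1 else if v = i + 1 then i else v"])
        (auto simp: d_op_def between_def move3_def swap_vals_def Let_def)
  next
    case 5 then show ?thesis using assms
      by (intro exI[of _ "\<lambda>v. if v = i then i + 1 else if v = i + 1 then i else v"])
        (auto simp: d_op_def between_def move3_def swap_vals_def Let_def)
  next
    case 6 then show ?thesis using assms
      by (intro exI[of _ "\<lambda>v. if v = i then i - 1 else if v = i - 1 then i else v"])
        (auto simp: d_op_def between_def move3_def swap_vals_def Let_def)
  qed
qed

lemma dt_op_map:
  assumes "index w (i - 1) = p" "index w i = q" "index w (i + 1) = r" "distinct [p, q, r]" "0 < i"
  shows "\<exists>f. dt_op i w = map f w \<and> (\<forall>v. v \<notin> {i - 1, i, i + 1} \<longrightarrow> f v = v) \<and>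
    map (\<lambda>x. f (if x = p then i - 1 else if x = q then i else i + 1)) (move3 (\<lambda>x y. False) p q r)
      = [i - 1, i, i + 1]"
proof -
  \<comment> \<open>On entries a rotation is a 3-cycle; its two directions serve the four orders in
    which \<open>q\<close> is extreme.\<close>
  let ?cyc = "\<lambda>a b c v. if v = a then b else if v = b then c else if v = c then a else v"
  consider "p < q" "q < r" | "r < q" "q < p" | "p < q" "r < q" "p < r" | "p < q" "r < q" "r < p"
    | "q < p" "q < r" "p < r" | "q < p" "q < r" "r < p"
    using assms(4) by fastforce
  then show ?thesis
  proof cases
    case 1 then show ?thesis using assms
      by (intro exI[of _ id]) (auto simp: dt_op_def between_def move3_def)
  next
    case 2 then show ?thesis using assms
      by (intro exI[of _ id]) (auto simp: dt_op_def between_def move3_def)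
  next
    case 3 then show ?thesis using assms
      by (intro exI[of _ "?cyc (i - 1) i (i + 1)"])
        (auto simp: dt_op_def between_def move3_def Let_def)
  next
    case 4 then show ?thesis using assms
      by (intro exI[of _ "?cyc (i - 1) (i + 1) i"])
        (auto simp: dt_op_def between_def move3_def Let_def)
  next
    case 5 then show ?thesis using assms
      by (intro exI[of _ "?cyc (i - 1) (i + 1) i"])
        (auto simp: dt_op_def between_def move3_def Let_def)
  next
    case 6 then show ?thesis using assms
      by (intro exI[of _ "?cyc (i - 1) i (i + 1)"])
        (auto simp: dt_op_def between_def move3_def Let_def)
  qed
qed

section \<open>Positions of cells and their shifted contents\<close>

locale skew_tuple =
  fixes ms :: "(nat list \<times> nat list) list"
  assumes nonempty: "length ms \<ge> 1"
    and skew: "\<forall>s \<in> set ms. is_skew s"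
begin

abbreviation "k \<equiv> length ms"
abbreviation "cl \<equiv> cell_list ms"
abbreviation "n \<equiv> tsize ms"
abbreviation "sc p \<equiv> scont k (cl ! p)"

definition adj :: "nat \<Rightarrow> nat \<Rightarrow> bool" where
  "adj p q \<longleftrightarrow> p < n \<and> q < n \<and> fst (cl ! p) = fst (cl ! q) \<and> cell_covers (snd (cl ! p)) (snd (cl ! q))"

definition distant :: "nat \<Rightarrow> nat \<Rightarrow> bool" where
  "distant p q \<longleftrightarrow> sc q - sc p > int k"

text \<open>A tableau is encoded by the list of the positions, in \<open>cell_list\<close>, of the cells with
  entries 1, 2, ...\<close>
definition cell_words :: "nat list set" where
  "cell_words = {L. distinct L \<and> set L = {..<n} \<and> sorted_wrt (\<lambda>p q. \<not> adj q p) L}"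

definition tab :: "nat list \<Rightarrow> nat \<times> (nat \<times> nat) \<Rightarrow> nat" where
  "tab L x = (if x \<in> set cl then Suc (index L (index cl x)) else 0)"

definition cell_key :: "nat \<times> (nat \<times> nat) \<Rightarrow> (int \<times> nat) \<times> (nat \<times> (nat \<times> nat))" where
  "cell_key x = ((scont k x, fst (snd x)), x)"

lemma finite_tcells: "finite (tcells ms)"
proof -
  have "tcells ms = (SIGMA i:{..<k}. skew_cells (ms ! i))" by (auto simp: tcells_def)
  then show ?thesis by (simp add: skew_cells_def card_cells_of)
qed

lemma cell_list_key: "map cell_key cl = sorted_list_of_set (cell_key ` tcells ms)"
proof -
  have "cell_key (snd y) = y" if "y \<in> cell_key ` tcells ms" for y
    using that by (auto simp: cell_key_def)
  then have "map (cell_key \<circ> snd) (sorted_list_of_set (cell_key ` tcells ms)) = sorted_list_of_set (cell_key ` tcells ms)"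
    using finite_tcells by (intro map_idI) auto
  then show ?thesis by (simp add: cell_list_def cell_key_def[abs_def])
qed

lemma cell_list_props: "distinct cl" "set cl = tcells ms" "length cl = n"
proof -
  show s: "set cl = tcells ms"
    using finite_tcells by (auto simp: cell_list_def image_image)
  show d: "distinct cl"
    using cell_list_key by (metis distinct_map distinct_sorted_list_of_set)
  show "length cl = n" using distinct_card[OF d] s by (simp add: tsize_def)
qed

lemma cell_key_le: "p \<le> q \<Longrightarrow> q < n \<Longrightarrow> cell_key (cl ! p) \<le> cell_key (cl ! q)"
proof -
  assume "p \<le> q" "q < n"
  moreover have "sorted (map cell_key cl)" by (simp add: cell_list_key)
  ultimately show ?thesis using sorted_nth_mono[of "map cell_key cl" p q] cell_list_props(3) by simp
qed

lemma sc_mono: "p \<le> q \<Longrightarrow> q < n \<Longrightarrow> sc p \<le> sc q"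
  using cell_key_le[of p q] by (auto simp: cell_key_def less_eq_prod_def)

lemma cl_nth: "p < n \<Longrightarrow> cl ! p \<in> tcells ms"
  using cell_list_props by (metis nth_mem)

text \<open>Modulo \<open>k\<close> the shifted content gives the component, whose index is below
  \<open>k\<close>. Then the contents agree, and the tie-break by column puts the cell at
  \<open>q\<close> further northeast.\<close>

lemma same_diagonal:
  assumes "p < q" "q < n" "sc p = sc q"
  obtains i a b d where "cl ! p = (i, (a, b))" "cl ! q = (i, (a + d, b + d))" "0 < d"
proof -
  obtain i a b where x: "cl ! p = (i, (a, b))" by (cases "cl ! p") auto
  obtain i' a' b' where y: "cl ! q = (i', (a', b'))" by (cases "cl ! q") auto
  have i: "i < k" "i' < k" using cl_nth[of p] cl_nth[of q] x y assms by (auto simp: tcells_def)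
  have e: "int k * content (a, b) + int i = int k * content (a', b') + int i'"
    using assms(3) x y by (simp add: scont_def)
  then have "(int k * content (a, b) + int i) mod int k = (int k * content (a', b') + int i') mod int k" by simp
  then have "i = i'" using i by simp
  with e nonempty have c: "content (a, b) = content (a', b')" by auto
  have "a \<le> a'" using cell_key_le[of p q] assms x y by (auto simp: cell_key_def less_eq_prod_def)
  moreover have "cl ! p \<noteq> cl ! q" using assms cell_list_props by (simp add: nth_eq_iff_index_eq)
  ultimately have "a < a'" using c x y \<open>i = i'\<close> by (cases "a = a'") (auto simp: content_def)
  then show thesis using that[of i a b "a' - a"] c x y \<open>i = i'\<close> by (auto simp: content_def)
qed

text \<open>A unit step changes the content by one. Adjacent cells are therefore exactly at the
  threshold: neither \<open>distant\<close> nor closer than \<open>k\<close>.\<close>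

lemma adj_sc: "adj p q \<Longrightarrow> \<bar>sc p - sc q\<bar> = int k"
  by (auto simp: adj_def cell_covers_def scont_def content_def algebra_simps)

lemma adj_index:
  assumes "L \<in> cell_words" "adj p q"
  shows "index L p < index L q"
proof (rule index_sorted_wrt[of adj])
  show "p \<in> set L" "q \<in> set L" using assms by (simp_all add: cell_words_def adj_def)
  show "p \<noteq> q" using assms(2) cell_covers_irrefl by (metis adj_def)
qed (use assms in \<open>simp_all add: cell_words_def\<close>)

lemma adjI:
  assumes "x \<in> tcells ms" "y \<in> tcells ms" "fst x = fst y" "cell_covers (snd x) (snd y)"
  shows "adj (index cl x) (index cl y)"
  using assms cell_list_props index_less[of x cl] index_less[of y cl] nth_index[of x cl] nth_index[of y cl]
  by (simp add: adj_def)

lemma diagonal_index_gap: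
  assumes L: "L \<in> cell_words" and pq: "p < q" "q < n" "sc p = sc q"
  shows "index L p + 3 \<le> index L q"
proof -
  obtain i a b d where x: "cl ! p = (i, (a, b))" and y: "cl ! q = (i, (a + d, b + d))" and d: "0 < d"
    using same_diagonal[OF pq] by metis
  define \<tau> where "\<tau> c = index L (index cl (i, c))" for c
  have i: "i < k" "(a, b) \<in> skew_cells (ms ! i)" "(a + d, b + d) \<in> skew_cells (ms ! i)"
    using cl_nth[of p] cl_nth[of q] x y pq by (auto simp: tcells_def)
  have t: "(i, c) \<in> tcells ms" if "c \<in> skew_cells (ms ! i)" for c using that i by (simp add: tcells_def)
  have sk: "is_skew (ms ! i)" using skew i by simp
  have "\<tau> (a, b) + 3 * d \<le> \<tau> (a + d, b + d)"
  proof (rule diagonal_gap[OF sk _ _ _ i(2,3)])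
    show "\<tau> (a, b) < \<tau> (Suc a, b)" if "(a, b) \<in> skew_cells (ms ! i)" "(Suc a, b) \<in> skew_cells (ms ! i)" for a b
      unfolding \<tau>_def using that t by (intro adj_index[OF L] adjI) (auto simp: cell_covers_def)
    show "\<tau> (a, b) < \<tau> (a, Suc b)" if "(a, b) \<in> skew_cells (ms ! i)" "(a, Suc b) \<in> skew_cells (ms ! i)" for a b
      unfolding \<tau>_def using that t by (intro adj_index[OF L] adjI) (auto simp: cell_covers_def)
    show "inj_on \<tau> (skew_cells (ms ! i))"
    proof (rule inj_onI)
      fix c c' assume c: "c \<in> skew_cells (ms ! i)" "c' \<in> skew_cells (ms ! i)" "\<tau> c = \<tau> c'"
      have "index cl (i, c) \<in> set L" "index cl (i, c') \<in> set L"
        using t c cell_list_props index_less[of _ cl] L by (auto simp: cell_words_def)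
      then have "index cl (i, c) = index cl (i, c')" using c(3) nth_index[of _ L] by (metis \<tau>_def)
      then have "(i, c) = (i, c')" using t c cell_list_props nth_index[of _ cl] by metis
      then show "c = c'" by simp
    qed
  qed
  moreover have "\<tau> (a, b) = index L p" "\<tau> (a + d, b + d) = index L q"
    using x y index_nth[OF cell_list_props(1), of p] index_nth[OF cell_list_props(1), of q] pq cell_list_props(3) by (auto simp: \<tau>_def)
  ultimately show ?thesis using d by simp
qed

text \<open>The entries belonging to three consecutive letters differ by at most 2, but on a common
  diagonal they would differ by at least 3.\<close>

lemma sc_distinct:
  assumes L: "L \<in> cell_words" and l: "L = u @ [p, q, r] @ v" and xy: "x \<in> {p, q, r}" "y \<in> {p, q, r}" "x < y"
  shows "sc x < sc y"
proof -
  have d: "distinct L" "set L = {..<n}" using L by (auto simp: cell_words_def)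
  then have y: "y < n" using l xy by auto
  have "index L p = length u" "index L q = Suc (length u)" "index L r = Suc (Suc (length u))"
    using index_nth[OF d(1), of "length u"] index_nth[OF d(1), of "Suc (length u)"]
      index_nth[OF d(1), of "Suc (Suc (length u))"] l by (auto simp: nth_append)
  then have "\<not> index L x + 3 \<le> index L y" using xy by auto
  then have "sc x \<noteq> sc y" using diagonal_index_gap[OF L xy(3) y] by auto
  then show ?thesis using sc_mono[of x y] xy(3) y by auto
qed

text \<open>A Knuth move interchanges the two extremes, which are more than \<open>k\<close> apart.
  A rotation carries the letter of middle size past both extremes, and strictness of
  \<open>sc\<close> places it less than \<open>k\<close> away from each. Adjacent cells, at distance
  exactly \<open>k\<close>, are never interchanged.\<close>

lemma move3_sorted:
  assumes "sorted_wrt (\<lambda>p q. \<not> adj q p) [p, q, r]" "distinct [p, q, r]"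
    and "\<And>x y. x \<in> {p, q, r} \<Longrightarrow> y \<in> {p, q, r} \<Longrightarrow> x < y \<Longrightarrow> sc x < sc y"
  shows "sorted_wrt (\<lambda>p q. \<not> adj q p) (move3 distant p q r)"
proof -
  have far: "\<not> adj x y" "\<not> adj y x" if "distant x y" for x y
    using adj_sc[of x y] adj_sc[of y x] that by (auto simp: distant_def)
  have near: "\<not> adj x z \<and> \<not> adj z x \<and> \<not> adj z y \<and> \<not> adj y z"
    if "\<not> distant x y" "x \<in> {p, q, r}" "y \<in> {p, q, r}" "z \<in> {p, q, r}" "x < z" "z < y" for x y z
    using adj_sc[of x z] adj_sc[of z x] adj_sc[of z y] adj_sc[of y z] that assms(3)[of x z] assms(3)[of z y]
    by (auto simp: distant_def)
  consider "p < q" "r < q" "p < r" | "p < q" "r < q" "r < p" | "q < p" "q < r" "p < r" | "q < p" "q < r" "r < p"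
    | "\<not> (p < q \<and> r < q)" "\<not> (q < p \<and> q < r)"
    using assms(2) by fastforce
  then show ?thesis
  proof cases
    case 1 then show ?thesis using assms(1) far[of p q] near[of p q r] by (cases "distant p q") (auto simp: move3_def)
  next
    case 2 then show ?thesis using assms(1) far[of r q] near[of r q p] by (cases "distant r q") (auto simp: move3_def)
  next
    case 3 then show ?thesis using assms(1) far[of q r] near[of q r p] by (cases "distant q r") (auto simp: move3_def)
  next
    case 4 then show ?thesis using assms(1) far[of q p] near[of q p r] by (cases "distant q p") (auto simp: move3_def)
  next
    case 5 then show ?thesis using assms(1) by (auto simp: move3_def)
  qed
qed

lemma length_cell_word: "L \<in> cell_words \<Longrightarrow> length L = n"
  using distinct_card[of L] by (simp add: cell_words_def)

lemma act_cell_words: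
  assumes L: "L \<in> cell_words" and j: "j + 2 < n"
  shows "act distant j L \<in> cell_words"
proof -
  have j': "j + 2 < length L" using length_cell_word[OF L] j by simp
  obtain u p q r v where l: "L = u @ [p, q, r] @ v" and e: "act distant j L = u @ move3 distant p q r @ v"
    using tripleE[OF j', of distant] by metis
  have "sorted_wrt (\<lambda>p q. \<not> adj q p) (move3 distant p q r)"
    using L l sc_distinct[OF L l] by (intro move3_sorted) (auto simp: cell_words_def sorted_wrt_append)
  then have "sorted_wrt (\<lambda>p q. \<not> adj q p) (act distant j L)"
    using L l unfolding e by (auto simp: cell_words_def sorted_wrt_append set_move3)
  then show ?thesis using L set_act[OF j', of distant] distinct_act[OF j', of distant] by (auto simp: cell_words_def)
qed

section \<open>The bijection between words of cells and standard tableaux\<close>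

lemma tab_nth:
  assumes "L \<in> cell_words" "t < n"
  shows "tab L (cl ! (L ! t)) = Suc t"
proof -
  have "L ! t < n" using assms length_cell_word[OF assms(1)] nth_mem[of t L] by (auto simp: cell_words_def)
  then show ?thesis using assms cell_list_props index_nth[of L t] index_nth[OF cell_list_props(1), of "L ! t"] length_cell_word[OF assms(1)]
    by (auto simp: tab_def cell_words_def)
qed

lemma tab_SYT: assumes L: "L \<in> cell_words" shows "tab L \<in> SYT ms"
proof -
  have d: "distinct L" "set L = {..<n}" "length L = n" using L length_cell_word by (auto simp: cell_words_def)
  have "bij_betw (index L \<circ> index cl) (tcells ms) {..<n}"
    using bij_betw_index[OF cell_list_props(1)] bij_betw_index[OF d(1)] cell_list_props d by (auto intro: bij_betw_trans)
  then have "bij_betw (Suc \<circ> (index L \<circ> index cl)) (tcells ms) {1..n}"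
    by (rule bij_betw_trans) (auto simp: bij_betw_def image_Suc_lessThan)
  then have "bij_betw (tab L) (tcells ms) {1..n}"
    by (subst bij_betw_cong) (auto simp: tab_def cell_list_props)
  then show ?thesis
    using adj_index[OF L adjI] by (auto simp: SYT_def is_SYT_def tab_def cell_list_props cell_covers_def)
qed

lemma tab_inj: "inj_on tab cell_words"
proof (rule inj_onI)
  fix L L' assume A: "L \<in> cell_words" "L' \<in> cell_words" "tab L = tab L'"
  show "L = L'"
  proof (rule nth_equalityI)
    show "length L = length L'" using A length_cell_word by simp
    fix t assume t: "t < length L"
    then have t: "t < n" using A length_cell_word by simp
    have p: "L ! t < n" "L ! t \<in> set L'" using A t length_cell_word[OF A(1)] nth_mem[of t L] by (auto simp: cell_words_def)
    have "tab L' (cl ! (L ! t)) = Suc t" using tab_nth[OF A(1) t] A(3) by simp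
    then have "index L' (L ! t) = t" using p cell_list_props index_nth[OF cell_list_props(1), of "L ! t"] by (auto simp: tab_def split: if_splits)
    then show "L ! t = L' ! t" using nth_index[OF p(2)] by simp
  qed
qed

lemma tab_surj: assumes T: "T \<in> SYT ms" shows "\<exists>L \<in> cell_words. tab L = T"
proof -
  have b: "bij_betw T (tcells ms) {1..n}" and z: "\<And>x. x \<notin> tcells ms \<Longrightarrow> T x = 0"
    using T by (auto simp: SYT_def is_SYT_def)
  have mono: "T x < T y" if "x \<in> tcells ms" "y \<in> tcells ms" "fst x = fst y" "cell_covers (snd x) (snd y)" for x y
  proof -
    obtain i a c where "x = (i, (a, c))" by (cases x) auto
    with that T show ?thesis by (cases y) (auto simp: SYT_def is_SYT_def cell_covers_def)
  qed
  \<comment> \<open>The cell with entry \<open>t + 1\<close>.\<close>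
  let ?x = "\<lambda>t. inv_into (tcells ms) T (Suc t)"
  have x: "?x t \<in> tcells ms" "T (?x t) = Suc t" if "t < n" for t
    using b that by (auto simp: bij_betw_def intro!: inv_into_into f_inv_into_f)
  have xT: "?x (T y - 1) = y" "T y - 1 < n" if "y \<in> tcells ms" for y
  proof -
    have "T y \<in> {1..n}" using b that by (auto simp: bij_betw_def)
    then show "?x (T y - 1) = y" "T y - 1 < n" using b that by (auto simp: bij_betw_def)
  qed
  define L where "L = map (\<lambda>t. index cl (?x t)) [0..<n]"
  have len: "length L = n" by (simp add: L_def)
  have nth: "cl ! (L ! t) = ?x t" "L ! t < n" if "t < n" for t
    using that x(1)[OF that] cell_list_props nth_index[of "?x t" cl] index_less[of "?x t" cl] by (auto simp: L_def)
  have d: "distinct L"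
    unfolding distinct_conv_nth using nth x len by (metis nat.inject)
  have "set L \<subseteq> {..<n}" using nth len by (auto simp: in_set_conv_nth)
  then have s: "set L = {..<n}" using distinct_card[OF d] len by (intro card_subset_eq) auto
  have "\<not> adj (L ! j) (L ! i)" if "i < j" "j < n" for i j
    using mono[of "?x j" "?x i"] x[of i] x[of j] nth[of i] nth[of j] that by (auto simp: adj_def)
  then have L: "L \<in> cell_words" using d s len by (auto simp: cell_words_def sorted_wrt_iff_nth_less)
  have "tab L y = T y" for y
  proof (cases "y \<in> tcells ms")
    case True
    then have "tab L (cl ! (L ! (T y - 1))) = Suc (T y - 1)" using tab_nth[OF L] xT by blast
    moreover have "T y \<in> {1..n}" using b True by (rule bij_betw_apply)
    moreover have "cl ! (L ! (T y - 1)) = y" using nth(1)[OF xT(2)[OF True]] xT(1)[OF True] by simp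
    ultimately show ?thesis by simp
  next
    case False then show ?thesis using z cell_list_props by (simp add: tab_def)
  qed
  then show ?thesis using L by blast
qed

lemma SYT_tab: "SYT ms = tab ` cell_words"
  using tab_SYT tab_surj by blast

lemma finite_SYT: "finite (SYT ms)"
proof -
  have "cell_words \<subseteq> {L. set L \<subseteq> {..<n} \<and> length L = n}"
    using length_cell_word by (auto simp: cell_words_def)
  then have "finite cell_words" using finite_lists_length_eq[of "{..<n}" n] finite_subset by auto
  then show ?thesis by (simp add: SYT_tab)
qed

text \<open>The reading word is the inverse of the permutation \<open>L\<close>, with entries
  counted from 1 and positions from 0. Descents of the tableau thereby become descents of
  \<open>L\<close>.\<close>

lemma reading_word_tab: "reading_word ms (tab L) = map (\<lambda>p. Suc (index L p)) [0..<n]"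
proof (rule nth_equalityI)
  fix p assume "p < length (reading_word ms (tab L))"
  then have "p < n" by (simp add: reading_word_def cell_list_props)
  then show "reading_word ms (tab L) ! p = map (\<lambda>p. Suc (index L p)) [0..<n] ! p"
    using index_nth[OF cell_list_props(1), of p] by (simp add: reading_word_def cell_list_props tab_def cl_nth)
qed (simp add: reading_word_def cell_list_props)

lemma index_reading_word:
  assumes L: "L \<in> cell_words" and t: "t < n"
  shows "index (reading_word ms (tab L)) (Suc t) = L ! t"
proof -
  let ?w = "map (\<lambda>p. Suc (index L p)) [0..<n]"
  have d: "distinct L" "set L = {..<n}" "length L = n" using L length_cell_word by (auto simp: cell_words_def)
  have p: "L ! t < n" using d t nth_mem[of t L] by auto
  have "inj_on (index L) {..<n}" using bij_betw_index[OF d(1)] d by (simp add: bij_betw_def)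
  then have "distinct ?w" by (auto simp: distinct_map inj_on_def)
  moreover have "?w ! (L ! t) = Suc t" using p d t index_nth[OF d(1)] by simp
  ultimately have "index ?w (Suc t) = L ! t" using index_nth[of ?w "L ! t"] p by simp
  then show ?thesis by (simp add: reading_word_tab)
qed

lemma des_tab: assumes L: "L \<in> cell_words" shows "des ms (tab L) = descent_positions (word_descents L)"
proof (intro equalityI subsetI)
  fix d assume "d \<in> des ms (tab L)"
  then obtain j where j: "d = Suc j" "Suc j < n"
      "index (reading_word ms (tab L)) (Suc (Suc j)) < index (reading_word ms (tab L)) (Suc j)"
    by (cases d) (auto simp: des_def Let_def)
  then show "d \<in> descent_positions (word_descents L)"
    using index_reading_word[OF L, of j] index_reading_word[OF L, of "Suc j"] length_cell_word[OF L]
    by (auto simp: descent_positions_descents)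
next
  fix d assume "d \<in> descent_positions (word_descents L)"
  then obtain j where "d = Suc j" "Suc j < n" "L ! Suc j < L ! j"
    using length_cell_word[OF L] by (auto simp: descent_positions_descents)
  then show "d \<in> des ms (tab L)"
    using index_reading_word[OF L, of j] index_reading_word[OF L, of "Suc j"]
    by (auto simp: des_def Let_def)
qed

text \<open>\<open>sc\<close> is weakly increasing in the position, so its maximum and minimum over
  the triple are attained at the extreme positions: the test in \<open>D_op\<close> is that of
  \<open>distant\<close>.\<close>

lemma move3_distant:
  assumes "p < n" "q < n" "r < n" "distinct [p, q, r]"
    and B: "Max {sc p, sc q, sc r} - Min {sc p, sc q, sc r} > int k \<longleftrightarrow> B"
  shows "move3 distant p q r = move3 (\<lambda>x y. B) p q r"
proof -
  have m: "distant x y \<longleftrightarrow> B" if "{x, y, z} = {p, q, r}" "x < z" "z < y" for x y z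
  proof -
    have "z \<in> {p, q, r}" "y \<in> {p, q, r}" using that(1) by blast+
    then have "z < n" "y < n" using assms by auto
    then have "sc x \<le> sc z" "sc z \<le> sc y" using that sc_mono[of x z] sc_mono[of z y] by auto
    then have "Max {sc x, sc y, sc z} = sc y" "Min {sc x, sc y, sc z} = sc x" by (auto simp: max_def min_def)
    moreover have "{sc p, sc q, sc r} = {sc x, sc y, sc z}" using arg_cong[OF that(1), of "\<lambda>A. (\<lambda>u. sc u) ` A"] by simp
    ultimately show ?thesis using B by (simp add: distant_def)
  qed
  consider "p < q" "r < q" "p < r" | "p < q" "r < q" "r < p" | "q < p" "q < r" "p < r" | "q < p" "q < r" "r < p"
    | "\<not> (p < q \<and> r < q)" "\<not> (q < p \<and> q < r)"
    using assms(4) by fastforce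
  then show ?thesis
  proof cases
    case 1 then show ?thesis using m[of p q r] by (auto simp: move3_def)
  next
    case 2 then show ?thesis using m[of r q p] by (auto simp: move3_def)
  next
    case 3 then show ?thesis using m[of q r p] by (auto simp: move3_def)
  next
    case 4 then show ?thesis using m[of q p r] by (auto simp: move3_def)
  next
    case 5 then show ?thesis by (simp add: move3_def)
  qed
qed

text \<open>The operator with index \<open>j + 2\<close> concerns the entries \<open>j + 1\<close>,
  \<open>j + 2\<close>, \<open>j + 3\<close>, whose positions stand at places \<open>j\<close>,
  \<open>j + 1\<close>, \<open>j + 2\<close> of \<open>L\<close>.\<close>

lemma D_op_tab:
  assumes L: "L \<in> cell_words" and j: "j + 2 < n"
  shows "D_op ms (j + 2) (tab L) = tab (act distant j L)"
proof -
  have d: "distinct L" "set L = {..<n}" "length L = n" using L length_cell_word by (auto simp: cell_words_def)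
  define p q r where "p = L ! j" and "q = L ! Suc j" and "r = L ! Suc (Suc j)"
  define i where "i = j + 2"
  let ?w = "reading_word ms (tab L)"
  have ix: "index ?w (i - 1) = p" "index ?w i = q" "index ?w (i + 1) = r"
    using index_reading_word[OF L, of j] index_reading_word[OF L, of "Suc j"]
      index_reading_word[OF L, of "Suc (Suc j)"] j by (auto simp: p_def q_def r_def i_def)
  have dist: "distinct [p, q, r]" using d j by (auto simp: p_def q_def r_def nth_eq_iff_index_eq)
  have lt: "p < n" "q < n" "r < n" using d j nth_mem[of _ L] by (auto simp: p_def q_def r_def)
  have ixL: "index L p = j" "index L q = Suc j" "index L r = Suc (Suc j)"
    using index_nth[OF d(1)] d j by (auto simp: p_def q_def r_def)
  define B where "B \<longleftrightarrow> Max {sc p, sc q, sc r} - Min {sc p, sc q, sc r} > int k"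
  define w' where "w' = (if B then d_op i ?w else dt_op i ?w)"
  have D: "D_op ms (j + 2) (tab L) = (\<lambda>x. if x \<in> set cl then w' ! index cl x else 0)"
    unfolding D_op_def Let_def i_def[symmetric] ix w'_def B_def ..
  have m: "move3 distant p q r = move3 (\<lambda>x y. B) p q r"
    by (rule move3_distant[OF lt dist]) (simp add: B_def)
  have "0 < i" by (simp add: i_def)
  have "\<exists>f. w' = map f ?w \<and> (\<forall>v. v \<notin> {i - 1, i, i + 1} \<longrightarrow> f v = v) \<and>
    map (\<lambda>x. f (if x = p then i - 1 else if x = q then i else i + 1)) (move3 distant p q r) = [i - 1, i, i + 1]"
  proof (cases B)
    case True
    with d_op_map[OF ix dist \<open>0 < i\<close>] show ?thesis by (simp only: m w'_def if_True)
  next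
    case False
    with dt_op_map[OF ix dist \<open>0 < i\<close>] show ?thesis by (simp only: m w'_def if_False)
  qed
  then obtain f where f: "w' = map f ?w" "\<forall>v. v \<notin> {i - 1, i, i + 1} \<longrightarrow> f v = v"
    "map (\<lambda>x. f (if x = p then i - 1 else if x = q then i else i + 1)) (move3 distant p q r) = [i - 1, i, i + 1]"
    by (elim exE conjE) (rule that)
  obtain p' q' r' where m': "move3 distant p q r = [p', q', r']"
    using length_move3[of distant p q r] unfolding numeral_3_eq_3 length_Suc_conv by auto
  have sub: "{p', q', r'} = {p, q, r}" using set_move3[of distant p q r] m' by auto
  have val: "Suc (index L x) = (if x = p then i - 1 else if x = q then i else i + 1)" if "x \<in> {p', q', r'}" for x
    using that ixL dist unfolding sub by (auto simp: i_def)
  let ?L = "act distant j L"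
  have L': "?L \<in> cell_words" using act_cell_words[OF L j] .
  have al: "?L = take j L @ [p', q', r'] @ drop (j + 3) L"
    using m' by (simp add: act_def p_def q_def r_def)
  \<comment> \<open>The cell at place \<open>t\<close> of the new word must receive
    \<open>t + 1\<close>. Outside the window \<open>f\<close> fixes its old entry; inside, the
    equation for \<open>move3\<close> applies.\<close>
  have ft: "f (Suc (index L (?L ! t))) = Suc t" if t: "t < n" for t
  proof -
    consider "t < j" | "t = j" | "t = Suc j" | "t = Suc (Suc j)" | "j + 3 \<le> t" by linarith
    then show ?thesis
    proof cases
      case 1
      then have "?L ! t = L ! t" using d j by (simp add: al nth_append)
      then show ?thesis using f(2) index_nth[OF d(1)] d t 1 by (simp add: i_def)
    next
      case 2
      then have "?L ! t = p'" using d j by (simp add: al nth_append)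
      then show ?thesis using f(3) val[of p'] m' 2 by (simp add: i_def)
    next
      case 3
      then have "?L ! t = q'" using d j by (simp add: al nth_append)
      then show ?thesis using f(3) val[of q'] m' 3 by (simp add: i_def)
    next
      case 4
      then have "?L ! t = r'" using d j by (simp add: al nth_append)
      then show ?thesis using f(3) val[of r'] m' 4 by (simp add: i_def)
    next
      case 5
      then have "?L ! t = L ! t" using d j t by (simp add: al nth_append)
      then show ?thesis using f(2) index_nth[OF d(1)] d t 5 by (simp add: i_def)
    qed
  qed
  have "w' ! index cl x = tab ?L x" if x: "x \<in> set cl" for x
  proof -
    have p: "index cl x < n" using x index_less cell_list_props by metis
    then have pL: "index cl x \<in> set ?L" using L' by (simp add: cell_words_def)
    have "f (Suc (index L (index cl x))) = Suc (index ?L (index cl x))"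
      using ft[of "index ?L (index cl x)"] nth_index[OF pL] index_less[OF pL] length_cell_word[OF L'] by simp
    then show ?thesis using p x by (simp add: f(1) reading_word_tab tab_def)
  qed
  then show ?thesis unfolding D by (auto simp: tab_def)
qed

end

section \<open>Classes of tableaux\<close>

lemma finite_partitions_of: "finite (partitions_of m)"
proof -
  have "length l \<le> sum_list l" if "0 \<notin> set l" for l :: "nat list"
    using that by (induction l) auto
  then have "partitions_of m \<subseteq> {l. set l \<subseteq> {..m} \<and> length l \<le> m}"
    using member_le_sum_list by (fastforce simp: partitions_of_def is_partition_def)
  then show ?thesis using finite_lists_length_le[of "{..m}" m] finite_subset by auto
qed

lemma schur_positiveI:
  assumes "set ls \<subseteq> partitions_of m" "\<And>a. f a = (\<Sum>l\<leftarrow>ls. schur_coeff l a)"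
  shows "schur_positive m f"
  unfolding schur_positive_def
  using sum_list_map_eq_sum_count2[OF assms(1) finite_partitions_of] assms(2)
  by (intro exI[of _ "count_list ls"]) simp

lemma single_schurI:
  assumes "set ls \<subseteq> partitions_of m" "\<And>a. f a = (\<Sum>l\<leftarrow>ls. schur_coeff l a)" "length ls = 1"
  shows "single_schur m f"
proof -
  obtain l where "ls = [l]" using assms(3) by (auto simp: length_Suc_conv)
  then show ?thesis using assms by (auto simp: single_schur_def)
qed

context skew_tuple
begin

text \<open>The operators with index \<open>h\<close> to \<open>i\<close> touch the entries
  \<open>h - 1\<close> to \<open>i + 1\<close>, which belong to the places \<open>h - 2\<close> to
  \<open>i\<close>.\<close>

definition segment :: "nat \<Rightarrow> nat \<Rightarrow> nat list \<Rightarrow> nat list" where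
  "segment h i L = take (i - h + 3) (drop (h - 2) L)"

definition insert_segment :: "nat \<Rightarrow> nat \<Rightarrow> nat list \<Rightarrow> nat list \<Rightarrow> nat list" where
  "insert_segment h i L v = take (h - 2) L @ v @ drop (Suc i) L"

lemma insert_segment_self:
  assumes "1 < h" "h \<le> i"
  shows "insert_segment h i L (segment h i L) = L"
proof -
  have "drop (i - h + 3) (drop (h - 2) L) = drop (Suc i) L"
    using assms by (auto simp: intro!: arg_cong[where f = "\<lambda>x. drop x L"])
  then show ?thesis unfolding insert_segment_def segment_def by (metis append_take_drop_id)
qed

lemma length_segment: "1 < h \<Longrightarrow> h \<le> i \<Longrightarrow> i < n \<Longrightarrow> L \<in> cell_words \<Longrightarrow> length (segment h i L) = i - h + 3"
  using length_cell_word by (simp add: segment_def)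

lemma act_insert_segment:
  assumes "1 < h" "i < n" "L \<in> cell_words" "j + 2 < length v" "h \<le> i"
  shows "act distant (h - 2 + j) (insert_segment h i L v) = insert_segment h i L (act distant j v)"
proof -
  have "length (take (h - 2) L) = h - 2" using assms length_cell_word by simp
  then show ?thesis using act_inside[OF assms(4), of distant "take (h - 2) L" "drop (Suc i) L"]
    by (simp add: insert_segment_def)
qed

text \<open>The operator with index \<open>h + j\<close> acts on the window at place
  \<open>j\<close> of the segment. So the class is that of the segment, with the rest of the word
  frozen.\<close>

lemma deq_class_tab:
  assumes hi: "1 < h" "h \<le> i" "i < n" and L: "L \<in> cell_words"
  shows "deq_class (SYT ms) (D_op ms) h i (tab L) =
      (\<lambda>v. tab (insert_segment h i L v)) ` reach distant (segment h i L)"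
    and "\<And>v. v \<in> reach distant (segment h i L) \<Longrightarrow> insert_segment h i L v \<in> cell_words"
proof -
  let ?W = "insert_segment h i L" and ?v = "segment h i L"
  have dv: "distinct ?v" using L by (simp add: segment_def cell_words_def)
  have len: "length v = i - h + 3" if "v \<in> reach distant ?v" for v
    using reach_perm[OF that dv] length_segment[OF hi L] by simp
  show W: "?W v \<in> cell_words" if "v \<in> reach distant ?v" for v
    using that
  proof (induction rule: reach_induct)
    case refl then show ?case using L insert_segment_self[OF hi(1,2)] by simp
  next
    case (step v j)
    have "h - 2 + j + 2 < n" using step.hyps len[OF step.hyps(1)] hi by simp
    then show ?case using act_insert_segment[OF hi(1,3) L step.hyps(2) hi(2)] act_cell_words[OF step.IH] by metis
  qed
  have D: "D_op ms (h + j) (tab (?W v)) = tab (?W (act distant j v))"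
    if "v \<in> reach distant ?v" "j \<le> i - h" for v j
  proof -
    have "h - 2 + j + 2 < n" "j + 2 < length v" using that len[OF that(1)] hi by auto
    moreover have "h - 2 + j + 2 = h + j" using hi by simp
    ultimately show ?thesis using D_op_tab[OF W[OF that(1)], of "h - 2 + j"]
      act_insert_segment[OF hi(1,3) L _ hi(2), of j v] by metis
  qed
  define R where "R = {(U, D_op ms j U) | U j. U \<in> SYT ms \<and> h \<le> j \<and> j \<le> i}"
  have cls: "deq_class (SYT ms) (D_op ms) h i (tab L) = {U. (tab L, U) \<in> (R \<union> R\<inverse>)\<^sup>*}"
    unfolding deq_class_def Let_def R_def ..
  \<comment> \<open>\<open>deq_class\<close> also follows the operators backwards; as involutions
    they give no new edges in that direction.\<close>
  have inv: "D_op ms j (D_op ms j U) = U" if U: "U \<in> SYT ms" and j: "h \<le> j" "j \<le> i" for U j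
  proof -
    obtain M where M: "M \<in> cell_words" "U = tab M" using U SYT_tab by auto
    obtain j' where j': "j = j' + 2" "j' + 2 < n" using j hi by (metis add.commute le_Suc_ex less_le_trans nat_less_le numeral_2_eq_2 Suc_leI One_nat_def le_trans le_less_trans)
    then show ?thesis
      using M D_op_tab[OF M(1) j'(2)] D_op_tab[OF act_cell_words[OF M(1) j'(2)] j'(2)]
        act_act[of j' M distant] length_cell_word[OF M(1)] by (simp add: cell_words_def)
  qed
  show "deq_class (SYT ms) (D_op ms) h i (tab L) = (\<lambda>v. tab (?W v)) ` reach distant ?v"
    unfolding cls
  proof (intro equalityI subsetI)
    fix U assume "U \<in> {U. (tab L, U) \<in> (R \<union> R\<inverse>)\<^sup>*}"
    then have "(tab L, U) \<in> (R \<union> R\<inverse>)\<^sup>*" by simp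
    then show "U \<in> (\<lambda>v. tab (?W v)) ` reach distant ?v"
    proof (induction rule: rtrancl_induct)
      case base
      then show ?case using insert_segment_self[OF hi(1,2), of L] by (metis imageI reach_refl)
    next
      case (step U U')
      then obtain v where v: "v \<in> reach distant ?v" "U = tab (?W v)" by auto
      obtain j where j: "h \<le> j" "j \<le> i" "U' = D_op ms j U"
      proof -
        consider "(U, U') \<in> R" | "(U', U) \<in> R" using step.hyps(2) by auto
        then show thesis
        proof cases
          case 1 then show thesis using that by (auto simp: R_def)
        next
          case 2 then show thesis using that inv by (auto simp: R_def)
        qed
      qed
      then have "U' = tab (?W (act distant (j - h) v))" using D[OF v(1), of "j - h"] v(2) by simp
      moreover have "act distant (j - h) v \<in> reach distant ?v"
        using reach_step[OF v(1)] len[OF v(1)] j hi by simp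
      ultimately show ?case by simp
    qed
  next
    fix U assume "U \<in> (\<lambda>v. tab (?W v)) ` reach distant ?v"
    then obtain v where v: "v \<in> reach distant ?v" "U = tab (?W v)" by auto
    from v(1) have "(tab L, tab (?W v)) \<in> (R \<union> R\<inverse>)\<^sup>*"
    proof (induction rule: reach_induct)
      case refl then show ?case by (simp add: insert_segment_self[OF hi(1,2)])
    next
      case (step v j)
      have j: "j \<le> i - h" using step.hyps(2) len[OF step.hyps(1)] by simp
      have "(tab (?W v), D_op ms (h + j) (tab (?W v))) \<in> R"
        unfolding R_def using tab_SYT[OF W[OF step.hyps(1)]] j hi by force
      then have "(tab (?W v), tab (?W (act distant j v))) \<in> R" using D[OF step.hyps(1) j] by simp
      then show ?case using step.IH by (meson UnI1 rtrancl.rtrancl_into_rtrancl)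
    qed
    then show "U \<in> {U. (tab L, U) \<in> (R \<union> R\<inverse>)\<^sup>*}" using v by simp
  qed
qed

lemma des_hi_tab:
  assumes hi: "1 < h" "h \<le> i" "i < n" and W: "insert_segment h i L v \<in> cell_words"
    and L: "L \<in> cell_words" and v: "length v = i - h + 3"
  shows "des_hi (des ms) h i (tab (insert_segment h i L v)) = descent_positions (word_descents v)"
proof -
  let ?W = "insert_segment h i L v"
  have nth: "?W ! (h - 2 + t) = v ! t" if "t < length v" for t
  proof -
    have "length (take (h - 2) L) = h - 2" using length_cell_word[OF L] hi by simp
    then show ?thesis using nth_append_length_plus[of "take (h - 2) L" "v @ drop (Suc i) L" t] that
      by (simp add: insert_segment_def nth_append_left)
  qed
  show ?thesis
  proof (intro equalityI subsetI)
    fix d assume "d \<in> des_hi (des ms) h i (tab ?W)"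
    then obtain t where t: "d = Suc t - (h - 2)" "h - 1 \<le> Suc t" "Suc t \<le> i" "?W ! Suc t < ?W ! t"
      by (auto simp: des_hi_def des_tab[OF W] descent_positions_descents)
    define t' where "t' = t - (h - 2)"
    have t': "t = h - 2 + t'" "Suc t' < length v" using t v hi by (auto simp: t'_def)
    then have "v ! Suc t' < v ! t'" using t(4) nth[of t'] nth[of "Suc t'"] by simp
    then show "d \<in> descent_positions (word_descents v)" using t' t(1) by (auto simp: descent_positions_descents)
  next
    fix d assume "d \<in> descent_positions (word_descents v)"
    then obtain t' where t': "d = Suc t'" "Suc t' < length v" "v ! Suc t' < v ! t'"
      by (auto simp: descent_positions_descents)
    have "Suc (h - 2 + t') \<in> descent_positions (word_descents ?W)"
      using t' nth[of t'] nth[of "Suc t'"] length_cell_word[OF W] v hi by (simp add: descent_positions_descents)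
    moreover have "Suc (h - 2 + t') \<in> {h - 1..i}" using t' v hi by auto
    moreover have "d = Suc (h - 2 + t') - (h - 2)" using t' by simp
    ultimately show "d \<in> des_hi (des ms) h i (tab ?W)" unfolding des_hi_def des_tab[OF W] by blast
  qed
qed

lemma qs_sum_tab:
  assumes hi: "1 < h" "h \<le> i" "i < n" and L: "L \<in> cell_words"
  shows "qs_sum (SYT ms) (des ms) (D_op ms) h i (tab L) a =
    (\<Sum>v \<in> reach distant (segment h i L). Q_coeff (i - h + 3) (descent_positions (word_descents v)) a)"
proof -
  let ?C = "reach distant (segment h i L)" and ?f = "\<lambda>v. tab (insert_segment h i L v)"
  have dv: "distinct (segment h i L)" using L by (simp add: segment_def cell_words_def)
  have inj: "inj_on ?f ?C"
  proof (rule inj_onI)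
    fix v w assume vw: "v \<in> ?C" "w \<in> ?C" "?f v = ?f w"
    then have "insert_segment h i L v = insert_segment h i L w"
      using inj_onD[OF tab_inj] deq_class_tab(2)[OF hi L] by blast
    then show "v = w" by (simp add: insert_segment_def)
  qed
  have "des_hi (des ms) h i (?f v) = descent_positions (word_descents v)" if "v \<in> ?C" for v
    using des_hi_tab[OF hi deq_class_tab(2)[OF hi L that] L] reach_perm[OF that dv] length_segment[OF hi L] by simp
  then show ?thesis
    unfolding qs_sum_def deq_class_tab(1)[OF hi L] sum.reindex[OF inj] by simp
qed

lemma windows_cases:
  assumes "(p, q, r, s) \<in> set (take (m - 3) windows)"
  shows "idx q = Suc (idx p) \<and> idx r = Suc (idx q) \<and> idx s = Suc (idx r) \<and> idx s < m"
proof -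
  obtain t where "t < m - 3" "t < 3" "windows ! t = (p, q, r, s)"
    using assms by (auto simp: in_set_conv_nth windows_def)
  then show ?thesis by (cases t rule: nat.exhaust[case_product nat.exhaust])
    (auto simp: windows_def nth_Cons split: nat.splits)
qed

lemma set_letters: "m \<le> 6 \<Longrightarrow> set (take m letters) = {l. idx l < m}"
proof -
  assume m: "m \<le> 6"
  have nth: "letters ! idx l = l" "idx l < 6" for l by (cases l; simp add: letters_def)+
  have idx: "idx (letters ! t) = t" if "t < 6" for t
  proof -
    have "t \<in> {0, 1, 2, 3, 4, 5}" using that by auto
    then show ?thesis by (auto simp: letters_def)
  qed
  have len: "length letters = 6" by (simp add: letters_def)
  show ?thesis
  proof (intro equalityI subsetI)
    fix l assume "l \<in> set (take m letters)"
    then show "l \<in> {l. idx l < m}" using m idx len by (auto simp: in_set_conv_nth)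
  next
    fix l assume "l \<in> {l. idx l < m}"
    then have "l = take m letters ! idx l" "idx l < length (take m letters)" using nth m len by auto
    then show "l \<in> set (take m letters)" by (metis nth_mem)
  qed
qed

text \<open>The word is standardised to the first \<open>m\<close> letters, so that the evaluation
  applies to its class. The assumption on \<open>x\<close> and \<open>y\<close> makes every word of
  the class part of a standard tableau, as the bound along diagonals requires.\<close>

lemma segment_expansion:
  assumes W: "\<And>v. v \<in> reach distant u \<Longrightarrow> x @ v @ y \<in> cell_words" and m: "length u = m" "m \<in> {3, 4, 5, 6}"
  shows "\<exists>ls. set ls \<subseteq> partitions_of m \<and>
    (\<forall>a. (\<Sum>v \<in> reach distant u. Q_coeff m (descent_positions (word_descents v)) a) = (\<Sum>l\<leftarrow>ls. schur_coeff l a)) \<and>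
    (m = 3 \<or> k \<le> 2 \<longrightarrow> length ls = 1)"
proof -
  have "x @ u @ y \<in> cell_words" using W reach_refl by blast
  then have u: "distinct u" "set u \<subseteq> {..<n}" by (auto simp: cell_words_def)
  define ps where "ps = sorted_list_of_set (set u)"
  have ps: "sorted ps" "distinct ps" "set ps = set u" "length ps = m"
    using m(1) u by (simp_all add: ps_def distinct_card)
  \<comment> \<open>The inverse of standardisation.\<close>
  define g where "g l = ps ! idx l" for l
  have "sorted_wrt (<) ps" using ps by (simp add: strict_sorted_iff)
  then have ps_less: "a < b \<Longrightarrow> b < m \<Longrightarrow> ps ! a < ps ! b" for a b
    using ps(4) by (simp add: sorted_wrt_iff_nth_less)
  have g_less: "g l < g l' \<longleftrightarrow> l < l'" if "idx l < m" "idx l' < m" for l l'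
    using that ps_less[of "idx l" "idx l'"] ps_less[of "idx l'" "idx l"]
    unfolding g_def less_letter_def by (cases "idx l" "idx l'" rule: linorder_cases) auto
  have g_n: "g l < n" if "idx l < m" for l using that ps u nth_mem[of "idx l" ps] by (auto simp: g_def)
  have g_inj: "l = l'" if "idx l < m" "idx l' < m" "g l = g l'" for l l'
    using g_less[of l l'] g_less[of l' l] that by (metis less_irrefl linorder_less_linear)
  have six: "m \<le> 6" using m(2) by auto
  have dl: "distinct (take m letters)" by (rule distinct_take) (simp add: letters_def)
  obtain v where v: "u = map g v" "distinct v" "length v = m" "set v = {l. idx l < m}"
  proof -
    define v where "v = map (\<lambda>p. letters ! index ps p) u"
    have L: "letters ! t \<in> {l. idx l < m} \<and> idx (letters ! t) = t" if "t < m" for t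
    proof -
      have "t \<in> {0, 1, 2, 3, 4, 5}" using that six by auto
      then show ?thesis using that by (auto simp: letters_def)
    qed
    have gu: "g (letters ! index ps p) = p" "letters ! index ps p \<in> {l. idx l < m}" if "p \<in> set u" for p
      using that L[of "index ps p"] index_less[of p ps] nth_index[of p ps] ps by (auto simp: g_def)
    have uv: "u = map g v" unfolding v_def using gu by (auto simp: comp_def intro!: map_idI[symmetric])
    then have dv: "distinct v" using u(1) by (metis distinct_map)
    have lv: "length v = m" using m by (simp add: v_def)
    have "set v \<subseteq> {l. idx l < m}" using gu by (auto simp: v_def)
    moreover have "card {l. idx l < m} = m"
      using distinct_card[OF dl] set_letters[OF six] six by (simp add: letters_def)
    moreover have "card (set v) = m" using distinct_card[OF dv] lv by simp
    moreover have "finite {l. idx l < m}" using set_letters[OF six] by (metis List.finite_set)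
    ultimately have "set v = {l. idx l < m}" by (intro card_subset_eq) simp_all
    with uv dv lv show thesis by (rule that)
  qed
  \<comment> \<open>Pairs reaching beyond the first \<open>m\<close> letters are declared far, which
    keeps the relation monotone.\<close>
  define Fx where "Fx l l' \<longleftrightarrow> m \<le> idx l' \<or> distant (g l) (g l')" for l l'
  define F where "F = Far (Fx L0 L2) (Fx L1 L3) (Fx L2 L4) (Fx L3 L5) (Fx L0 L3) (Fx L1 L4) (Fx L2 L5)
    (Fx L0 L4) (Fx L1 L5) (Fx L0 L5)"
  have far: "far F l l' = Fx l l'" if "idx l + 2 \<le> idx l'" for l l'
    using that by (cases l; cases l') (simp_all add: F_def)
  have Fx_mono: "Fx a b" if "Fx l l'" "a \<le> l" "l' \<le> b" "l \<le> l'" for l l' a b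
  proof (cases "m \<le> idx b")
    case False
    then have "idx l < m" "idx l' < m" "idx a < m" "idx b < m" using that by (auto simp: less_eq_letter_def)
    moreover from this have "g a \<le> g l" "g l' \<le> g b"
      using that g_less[of l a] g_less[of b l'] by (simp_all flip: not_less)
    ultimately have "sc (g a) \<le> sc (g l)" "sc (g l') \<le> sc (g b)"
      using g_n by (auto intro: sc_mono)
    moreover note \<open>idx l' < m\<close>
    ultimately show ?thesis using that(1) by (auto simp: Fx_def distant_def)
  qed (simp add: Fx_def)
  have mono: "monotone_far F"
    by (auto simp: F_def elim!: Fx_mono simp: less_eq_letter_def)
  have R: "reach distant u = map g ` reach (far F) v"
    unfolding v(1)
  proof (rule reach_map)
    show "g l < g l' \<longleftrightarrow> l < l'" if "l \<in> set v" "l' \<in> set v" for l l' using that v(4) g_less by simp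
    show "distant (g l) (g l') = far F l l'" if "{l, l', l''} \<subseteq> set v" "l < l''" "l'' < l'" for l l' l''
      using that v(4) far[of l l'] by (auto simp: Fx_def less_letter_def)
  qed (rule v(2))
  obtain ls where ls: "set ls \<subseteq> partitions_of m"
      "\<forall>a. (\<Sum>w \<in> reach (far F) v. Q_coeff m (descent_positions (word_descents w)) a) = (\<Sum>l\<leftarrow>ls. schur_coeff l a)"
      "length ls = 1 \<or> (\<exists>w \<in> reach (far F) v. \<not> spread (far F) (take (m - 3) windows) w)"
    using class_expansion[OF mono m(2) v(2,3)] v(4) set_letters[OF six] by auto
  have vs: "set w = {l. idx l < m}" if "w \<in> reach (far F) v" for w
    using reach_perm[OF that v(2)] v(4) by simp
  have inj: "inj_on (map g) (reach (far F) v)"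
    by (rule inj_onI, rule map_inj_on) (use vs g_inj in \<open>auto intro!: inj_onI\<close>)
  have dg: "word_descents (map g w) = word_descents w" if "w \<in> reach (far F) v" for w
    by (rule word_descents_map) (use vs[OF that] g_less in auto)
  have sum: "(\<Sum>v \<in> reach distant u. Q_coeff m (descent_positions (word_descents v)) a) =
      (\<Sum>w \<in> reach (far F) v. Q_coeff m (descent_positions (word_descents w)) a)" for a
    unfolding R sum.reindex[OF inj] using dg by simp
  have "spread (far F) (take (m - 3) windows) w" if w: "w \<in> reach (far F) v" and k: "k \<le> 2" for w
    unfolding spread_def
  proof (clarify, goal_cases)
    case (1 p q r s)
    have i: "idx q = Suc (idx p)" "idx r = Suc (idx q)" "idx s = Suc (idx r)" "idx s < m"
      using windows_cases[OF 1(1)] by auto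
    let ?W = "x @ map g w @ y"
    have Wc: "?W \<in> cell_words" using W R w by blast
    then have dW: "distinct ?W" by (simp add: cell_words_def)
    have ix: "index ?W (g l) = length x + index w l" if "idx l < m" for l
    proof -
      have "l \<in> set w" using vs[OF w] that by simp
      then have "index w l < length w" "w ! index w l = l" by (simp_all add: index_less nth_index)
      then have "?W ! (length x + index w l) = g l" "length x + index w l < length ?W"
        by (auto simp: nth_append)
      then show ?thesis using index_nth[OF dW] by metis
    qed
    have gap: "gap w l l'" if "idx l' = Suc (idx l)" "idx l' < m" "sc (g l) = sc (g l')" for l l'
    proof -
      have "g l < g l'" using g_less[of l l'] that by (simp add: less_letter_def)
      then have "index ?W (g l) + 3 \<le> index ?W (g l')"
        using diagonal_index_gap[OF Wc _ _ that(3)] g_n that by simp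
      then show ?thesis using ix that by (simp add: gap_def)
    qed
    have "\<not> distant (g p) (g s)" using 1(2) far[of p s] i by (auto simp: Fx_def)
    then have "sc (g s) - sc (g p) \<le> 2" using k by (simp add: distant_def)
    moreover have "sc (g l) \<le> sc (g l')" if "idx l' = Suc (idx l)" "idx l' < m" for l l'
      using g_less[of l l'] that g_n by (intro sc_mono) (auto simp: less_letter_def)
    \<comment> \<open>Three nonnegative integer increments have sum at most 2, so one of them is
      zero and its two letters lie on a common diagonal.\<close>
    ultimately have "sc (g p) = sc (g q) \<or> sc (g q) = sc (g r) \<or> sc (g r) = sc (g s)"
      using i by (smt (verit) Suc_lessD)
    then show ?case using gap[of q p] gap[of r q] gap[of s r] 1 i by auto
  qed
  \<comment> \<open>For \<open>m = 3\<close> the list of windows is empty.\<close>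
  moreover have "spread (far F) (take (m - 3) windows) w" if "m = 3" for w
    using that by (simp add: spread_def)
  ultimately have "m = 3 \<or> k \<le> 2 \<longrightarrow> length ls = 1" using ls(3) by blast
  then show ?thesis using ls(1,2) sum by auto
qed

text \<open>The bound \<open>i - h \<le> 3\<close> limits the segment to six letters, the largest
  length evaluated; \<open>h = i\<close> is the case of three letters.\<close>

lemma qs_sum_expansion:
  assumes "1 < h" "h \<le> i" "i < n" "i - h \<le> 3" "T \<in> SYT ms"
  shows "\<exists>ls. set ls \<subseteq> partitions_of (i - h + 3) \<and>
    (\<forall>a. qs_sum (SYT ms) (des ms) (D_op ms) h i T a = (\<Sum>l\<leftarrow>ls. schur_coeff l a)) \<and>
    (h = i \<or> k \<le> 2 \<longrightarrow> length ls = 1)"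
proof -
  obtain L where L: "L \<in> cell_words" "T = tab L" using assms(5) SYT_tab by auto
  have "i - h + 3 \<in> {3, 4, 5, 6}" using assms(4) by auto
  from segment_expansion[OF deq_class_tab(2)[OF assms(1-3) L(1), unfolded insert_segment_def]
      length_segment[OF assms(1-3) L(1)] this]
  show ?thesis using qs_sum_tab[OF assms(1-3) L(1)] L(2) by auto
qed

lemma D_op_SYT:
  assumes "1 < i" "i < n" "T \<in> SYT ms"
  shows "D_op ms i T \<in> SYT ms \<and> D_op ms i (D_op ms i T) = T"
proof -
  obtain L where L: "L \<in> cell_words" "T = tab L" using assms(3) SYT_tab by auto
  define j where "j = i - 2"
  have j: "i = j + 2" "j + 2 < n" using assms by (auto simp: j_def)
  have a: "act distant j L \<in> cell_words" using act_cell_words[OF L(1) j(2)] .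
  have "act distant j (act distant j L) = L"
    using act_act[of j L distant] length_cell_word[OF L(1)] j(2) L(1) by (simp add: cell_words_def)
  then show ?thesis
    using D_op_tab[OF L(1) j(2)] D_op_tab[OF a j(2)] tab_SYT[OF a] L(2) j(1) by simp
qed

text \<open>The windows start at places \<open>i - 2\<close> and \<open>j - 2\<close> and have three
  letters each, so \<open>i + 3 \<le> j\<close> makes them disjoint.\<close>

lemma D_op_commute:
  assumes "1 < i" "i + 3 \<le> j" "j < n" "T \<in> SYT ms"
  shows "D_op ms i (D_op ms j T) = D_op ms j (D_op ms i T)"
proof -
  obtain L where L: "L \<in> cell_words" "T = tab L" using assms(4) SYT_tab by auto
  define i' j' where "i' = i - 2" and "j' = j - 2"
  have e: "i = i' + 2" "j = j' + 2" "i' + 2 < n" "j' + 2 < n" "i' + 2 < j'" "j' + 2 < length L"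
    using assms length_cell_word[OF L(1)] by (auto simp: i'_def j'_def)
  show ?thesis
    using D_op_tab[OF L(1) e(3)] D_op_tab[OF L(1) e(4)]
      D_op_tab[OF act_cell_words[OF L(1) e(3)] e(4)] D_op_tab[OF act_cell_words[OF L(1) e(4)] e(3)]
      act_commute[OF e(5,6)] L(2) e(1,2) by simp
qed

lemma weak_dual_equivalence_D_op: "weak_dual_equivalence (SYT ms) (des ms) n (D_op ms)"
  unfolding weak_dual_equivalence_def
proof (intro conjI allI impI ballI)
  show "finite (SYT ms)" by (rule finite_SYT)
  show "D_op ms i T \<in> SYT ms" "D_op ms i (D_op ms i T) = T" if "1 < i \<and> i < n" "T \<in> SYT ms" for i T
    using D_op_SYT that by auto
  show "schur_positive (i - h + 3) (qs_sum (SYT ms) (des ms) (D_op ms) h i T)"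
    if "1 < h \<and> h \<le> i \<and> i < n \<and> i - h \<le> 3 \<and> T \<in> SYT ms" for h i T
    using qs_sum_expansion[of h i T] that by (blast intro: schur_positiveI)
  show "single_schur (i - h + 3) (qs_sum (SYT ms) (des ms) (D_op ms) h i T)"
    if "1 < h \<and> h \<le> i \<and> i < n \<and> i - h \<le> 3 \<and> T \<in> SYT ms" "h = i" for h i T
    using qs_sum_expansion[of h i T] that by (blast intro: single_schurI)
  show "D_op ms i (D_op ms j T) = D_op ms j (D_op ms i T)"
    if "1 < i \<and> i < n \<and> 1 < j \<and> j < n \<and> (i + 3 \<le> j \<or> j + 3 \<le> i)" "T \<in> SYT ms" for i j T
    using D_op_commute[of i j T] D_op_commute[of j i T] that by auto
qed

lemma dual_equivalence_D_op:
  assumes "k \<le> 2" shows "dual_equivalence (SYT ms) (des ms) n (D_op ms)"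
  unfolding dual_equivalence_def
proof (intro conjI allI impI)
  show "single_schur (i - h + 3) (qs_sum (SYT ms) (des ms) (D_op ms) h i T)"
    if "1 < h \<and> h \<le> i \<and> i < n \<and> i - h \<le> 3 \<and> T \<in> SYT ms" for h i T
    using qs_sum_expansion[of h i T] that assms by (blast intro: single_schurI)
qed (rule weak_dual_equivalence_D_op)

end

theorem theorem5p3:
  fixes ms :: "(nat list \<times> nat list) list"
  assumes "length ms \<ge> 1"
    and "\<forall>s \<in> set ms. is_skew s"
  shows "weak_dual_equivalence (SYT ms) (des ms) (tsize ms) (D_op ms)
       \<and> (length ms \<le> 2 \<longrightarrow> dual_equivalence (SYT ms) (des ms) (tsize ms) (D_op ms))"
proof -
  interpret skew_tuple ms by unfold_locales (rule assms)+
  show ?thesis using weak_dual_equivalence_D_op dual_equivalence_D_op by blast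
qed

end
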